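(* Let $\mu>0$ and $\gamma\in\mathbb{R}$. Then $\sigma_{\rm ess}(\mathcal{A}_\mu)=\Sigma_\mu$. Moreover, the set $\Sigma_\mu$ is the union of at most three bounded closed intervals.
   Context: $\mathbb{T}^3=(-\pi,\pi]^3$ is the three-dimensional torus with normalized Haar measure. $\mathcal{H}_1=L_2(\mathbb{T}^3)$, $\mathcal{H}_2=L_2^{\rm s}((\mathbb{T}^3)^2)$ (square-integrable symmetric functions), $\mathcal{H}=\mathcal{H}_1\oplus\mathcal{H}_2$. Let $\varepsilon(k)=\sum_{i=1}^3(1-\cos k_i)$, $w_1(k)=\varepsilon(k)+\gamma$, $w_2(k,p)=\varepsilon(k)+\varepsilon(\tfrac12(k+p))+\varepsilon(p)$. For $\mu>0$, $\mathcal{A}_\mu=\begin{pmatrix}A_{11}&\mu A_{12}\\ \mu A_{12}^*&A_{22}\end{pmatrix}$ on $\mathcal{H}$ with $(A_{11}f_1)(k)=w_1(k)f_1(k)$, $(A_{12}f_2)(k)=\int_{\mathbb{T}^3}f_2(k,s)ds$, $(A_{12}^*f_1)(k,p)=\tfrac12(f_1(k)+f_1(p))$, $(A_{22}f_2)(k,p)=w_2(k,p)f_2(k,p)$. For $k\in\mathbb{T}^3$: $m(k)=\min_p w_2(k,p)$, $M(k)=\max_p w_2(k,p)$, $I(k;z)=\int_{\mathbb{T}^3}\frac{dt}{w_2(k,t)-z}$, $\Delta_\mu(k;z)=w_1(k)-z-\frac{\mu^2}{2}I(k;z)$ for $z\notin[m(k),M(k)]$. The generalized Friedrichs model $\mathcal{A}_\mu(k)$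 on $\mathbb{C}\oplus L_2(\mathbb{T}^3)$ is $\mathcal{A}_\mu(k)(f_0,f_1)=\big(w_1(k)f_0+\tfrac{\mu}{\sqrt2}\int f_1(t)dt,\ \tfrac{\mu}{\sqrt2}f_0+w_2(k,\cdot)f_1\big)$, whose discrete spectrum is $\{z\notin[m(k),M(k)]:\Delta_\mu(k;z)=0\}$. $m=\min_{k,p}w_2$, $M=\max_{k,p}w_2$, $\Lambda_\mu=\bigcup_{k}\sigma_{\rm disc}(\mathcal{A}_\mu(k))$, $\Sigma_\mu=[m,M]\cup\Lambda_\mu$. *)

theory Defs
  imports "HOL-Analysis.Analysis"
begin

text \<open>The torus (-pi,pi]^3 as a subset of real^3, with normalized Haar
(= normalized Lebesgue) measure.\<close>

definition Tbox :: "(real^3) set" where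
  "Tbox = {x. \<forall>i. - pi < x $ i \<and> x $ i \<le> pi}"

definition T3 :: "(real^3) measure" where
  "T3 = uniform_measure lborel Tbox"

definition eps :: "real^3 \<Rightarrow> real" where
  "eps k = (\<Sum>i\<in>UNIV. 1 - cos (k $ i))"

definition w1 :: "real \<Rightarrow> real^3 \<Rightarrow> real" where
  "w1 \<gamma> k = eps k + \<gamma>"

definition w2 :: "real^3 \<Rightarrow> real^3 \<Rightarrow> real" where
  "w2 k p = eps k + eps ((1/2) *\<^sub>R (k + p)) + eps p"

text \<open>Elements of H = H1 (+) H2 are represented by pairs of functions;
H2 consists of symmetric square-integrable functions on T^3 x T^3.\<close>

type_synonym hvec = "(real^3 \<Rightarrow> complex) \<times> ((real^3) \<times> (real^3) \<Rightarrow> complex)"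

definition Hspace :: "hvec set" where
  "Hspace = {f. fst f \<in> borel_measurable T3
              \<and> integrable T3 (\<lambda>k. (cmod (fst f k))\<^sup>2)
              \<and> snd f \<in> borel_measurable (T3 \<Otimes>\<^sub>M T3)
              \<and> integrable (T3 \<Otimes>\<^sub>M T3) (\<lambda>x. (cmod (snd f x))\<^sup>2)
              \<and> (\<forall>k p. snd f (k, p) = snd f (p, k))}"

definition Hinner :: "hvec \<Rightarrow> hvec \<Rightarrow> complex" where
  "Hinner f g = (\<integral>k. fst f k * cnj (fst g k) \<partial>T3)
              + (\<integral>x. snd f x * cnj (snd g x) \<partial>(T3 \<Otimes>\<^sub>M T3))"

definition Hnorm :: "hvec \<Rightarrow> real" where
  "Hnorm f = sqrt ((\<integral>k. (cmod (fst f k))\<^sup>2 \<partial>T3)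
                 + (\<integral>x. (cmod (snd f x))\<^sup>2 \<partial>(T3 \<Otimes>\<^sub>M T3)))"

definition Aop :: "real \<Rightarrow> real \<Rightarrow> hvec \<Rightarrow> hvec" where
  "Aop \<gamma> \<mu> f =
     (\<lambda>k. complex_of_real (w1 \<gamma> k) * fst f k
            + complex_of_real \<mu> * (\<integral>s. snd f (k, s) \<partial>T3),
      \<lambda>(k, p). complex_of_real \<mu> * ((fst f k + fst f p) / 2)
            + complex_of_real (w2 k p) * snd f (k, p))"

text \<open>Essential spectrum of an operator on H (for bounded self-adjoint
operators), via singular Weyl sequences: z is in the essential spectrum iff
there is a sequence of unit vectors converging weakly to 0 with
||(A - z) phi_n|| \<rightarrow> 0.\<close>

definition ess_spectrum :: "(hvec \<Rightarrow> hvec) \<Rightarrow> complex set" where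
  "ess_spectrum A = {z. \<exists>\<phi> :: nat \<Rightarrow> hvec.
       (\<forall>n. \<phi> n \<in> Hspace \<and> Hnorm (\<phi> n) = 1)
     \<and> (\<forall>\<psi>\<in>Hspace. (\<lambda>n. Hinner (\<phi> n) \<psi>) \<longlonglongrightarrow> 0)
     \<and> (\<lambda>n. Hnorm (\<lambda>k. fst (A (\<phi> n)) k - z * fst (\<phi> n) k,
                     \<lambda>x. snd (A (\<phi> n)) x - z * snd (\<phi> n) x)) \<longlonglongrightarrow> 0}"

definition mk :: "real^3 \<Rightarrow> real" where
  "mk k = (INF p\<in>Tbox. w2 k p)"

definition Mk :: "real^3 \<Rightarrow> real" where
  "Mk k = (SUP p\<in>Tbox. w2 k p)"

definition Ik :: "real^3 \<Rightarrow> real \<Rightarrow> real" where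
  "Ik k z = (\<integral>t. 1 / (w2 k t - z) \<partial>T3)"

definition Delta :: "real \<Rightarrow> real \<Rightarrow> real^3 \<Rightarrow> real \<Rightarrow> real" where
  "Delta \<gamma> \<mu> k z = w1 \<gamma> k - z - (\<mu>\<^sup>2 / 2) * Ik k z"

text \<open>Discrete spectrum of the generalized Friedrichs model A_mu(k),
as given in the context.\<close>

definition disc_spec_k :: "real \<Rightarrow> real \<Rightarrow> real^3 \<Rightarrow> real set" where
  "disc_spec_k \<gamma> \<mu> k = {z. z \<notin> {mk k .. Mk k} \<and> Delta \<gamma> \<mu> k z = 0}"

definition m_min :: real where
  "m_min = (INF x\<in>Tbox \<times> Tbox. w2 (fst x) (snd x))"

definition M_max :: real where
  "M_max = (SUP x\<in>Tbox \<times> Tbox. w2 (fst x) (snd x))"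

definition Lambda :: "real \<Rightarrow> real \<Rightarrow> real set" where
  "Lambda \<gamma> \<mu> = (\<Union>k\<in>Tbox. disc_spec_k \<gamma> \<mu> k)"

definition Sigma_mu :: "real \<Rightarrow> real \<Rightarrow> real set" where
  "Sigma_mu \<gamma> \<mu> = {m_min .. M_max} \<union> Lambda \<gamma> \<mu>"

end

theory Submission
  imports Defs "HOL-Probability.Probability_Measure"
begin

text \<open>Eliminating the second component from \<open>(A - z) \<phi> = r\<close> turns the equation into
  \<open>\<Delta>(k; z) f(k) = r' + K f\<close>, where \<open>K\<close> maps weakly null sequences to norm-null ones. Hence a Weyl
  sequence can exist off \<open>[m, M] = [0, 18]\<close> only if \<open>\<Delta>(\<cdot>; z)\<close> is not bounded away from zero, i.e. has
  a zero; conversely, at a zero \<open>k\<close>, and at every point of the range of \<open>w2\<close>, functions concentrated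
  near one point form a Weyl sequence. Below \<open>0\<close> and above \<open>18\<close> the function \<open>\<Delta>(k; \<cdot>)\<close> is strictly
  decreasing and \<open>\<Delta>(\<cdot>; z)\<close> is continuous on a connected set, so the zeros in either half-line form
  an interval.

  The half-angle in \<open>w2\<close> makes it discontinuous on the torus; compactness arguments therefore use the
  closed cube, whose points are moved back to the torus box by reflecting coordinates.\<close>

section \<open>Square-integrable functions\<close>

text \<open>The coupling term \<open>(f(k) + f(p)) / 2\<close> has two parts that behave
  differently. After division by \<open>w2 - z\<close> and integration over \<open>p\<close>, the
  part \<open>f(k)\<close> is only multiplied by \<open>I(k; z)\<close> and completes \<Delta>,
  which explains the coefficient mu^2 / 2; the part \<open>f(p)\<close> yields an integral operator
  with bounded kernel. Compactness of that operator is never stated: testing weak convergence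
  against each section of the kernel gives pointwise convergence, and dominated convergence on a
  probability space does the rest. Since \<open>ess_spectrum\<close> admits complex
  \<open>z\<close>, nonreal points must be excluded too; there the imaginary parts of
  \<open>-z\<close> and of the integral term have the same sign and cannot cancel. The endpoints 0
  and 18 are delicate because the bounds on \<open>1 / (w2 - z)\<close> degenerate there: zeros are
  studied at a fixed distance from [0, 18], and limits that reach 0 or 18 are absorbed by [0, 18]
  itself.\<close>

definition sq_int :: "'a measure \<Rightarrow> ('a \<Rightarrow> complex) \<Rightarrow> bool" where
  "sq_int M f \<longleftrightarrow> f \<in> borel_measurable M \<and> integrable M (\<lambda>x. (cmod (f x))\<^sup>2)"

text \<open>Squared norms are used throughout: the two components of a vector then simply add, and
  limits to zero need no roots.\<close>

definition nsq :: "'a measure \<Rightarrow> ('a \<Rightarrow> complex) \<Rightarrow> real" where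
  "nsq M f = (\<integral>x. (cmod (f x))\<^sup>2 \<partial>M)"

lemma sq_int_measurable: "sq_int M f \<Longrightarrow> f \<in> borel_measurable M"
  by (simp add: sq_int_def)

lemma nsq_nonneg: "0 \<le> nsq M f"
  by (simp add: nsq_def)

lemma nsq_dominated:
  assumes f: "sq_int M f" and g: "g \<in> borel_measurable M"
    and le: "AE x in M. cmod (g x) \<le> C * cmod (f x)"
  shows sq_int_dominated: "sq_int M g" and "nsq M g \<le> C\<^sup>2 * nsq M f"
proof -
  have f2: "integrable M (\<lambda>x. C\<^sup>2 * (cmod (f x))\<^sup>2)"
    using f by (simp add: sq_int_def)
  have le2: "AE x in M. (cmod (g x))\<^sup>2 \<le> C\<^sup>2 * (cmod (f x))\<^sup>2"
    using le
  proof eventually_elim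
    case (elim x)
    then have "(cmod (g x))\<^sup>2 \<le> (C * cmod (f x))\<^sup>2"
      by (intro power_mono) auto
    then show ?case by (simp add: power_mult_distrib)
  qed
  have g2: "integrable M (\<lambda>x. (cmod (g x))\<^sup>2)"
    using le2 by (intro Bochner_Integration.integrable_bound[OF f2]) (use g in auto)
  then show "sq_int M g" using g by (simp add: sq_int_def)
  have "nsq M g \<le> (\<integral>x. C\<^sup>2 * (cmod (f x))\<^sup>2 \<partial>M)"
    unfolding nsq_def by (rule integral_mono_AE[OF g2 f2 le2])
  then show "nsq M g \<le> C\<^sup>2 * nsq M f" by (simp add: nsq_def)
qed

text \<open>Rests on (a + b)^2 \<le> 2 a^2 + 2 b^2. The factor 2 is harmless, since the estimates
  built on it only have to tend to zero.\<close>

lemma nsq_add: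
  assumes f: "sq_int M f" and g: "sq_int M g"
  shows sq_int_add: "sq_int M (\<lambda>x. f x + g x)"
    and "nsq M (\<lambda>x. f x + g x) \<le> 2 * nsq M f + 2 * nsq M g"
proof -
  have le: "(cmod (f x + g x))\<^sup>2 \<le> 2 * (cmod (f x))\<^sup>2 + 2 * (cmod (g x))\<^sup>2" for x
  proof -
    have "(cmod (f x + g x))\<^sup>2 \<le> (cmod (f x) + cmod (g x))\<^sup>2"
      by (intro power_mono norm_triangle_ineq) auto
    also have "\<dots> \<le> 2 * (cmod (f x))\<^sup>2 + 2 * (cmod (g x))\<^sup>2"
      using zero_le_power2[of "cmod (f x) - cmod (g x)"]
      by (simp add: power2_eq_square algebra_simps)
    finally show ?thesis .
  qed
  have [measurable]: "f \<in> borel_measurable M" "g \<in> borel_measurable M"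
    using f g by (auto simp: sq_int_def)
  have i: "integrable M (\<lambda>x. 2 * (cmod (f x))\<^sup>2 + 2 * (cmod (g x))\<^sup>2)"
    using f g by (auto simp: sq_int_def)
  have i2: "integrable M (\<lambda>x. (cmod (f x + g x))\<^sup>2)"
    by (rule Bochner_Integration.integrable_bound[OF i]) (use le in auto)
  then show "sq_int M (\<lambda>x. f x + g x)" by (simp add: sq_int_def)
  have "nsq M (\<lambda>x. f x + g x) \<le> (\<integral>x. 2 * (cmod (f x))\<^sup>2 + 2 * (cmod (g x))\<^sup>2 \<partial>M)"
    unfolding nsq_def by (rule integral_mono[OF i2 i le])
  then show "nsq M (\<lambda>x. f x + g x) \<le> 2 * nsq M f + 2 * nsq M g"
    using f g by (simp add: nsq_def sq_int_def)
qed

lemma sq_int_cmult: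
  assumes "sq_int M f" shows "sq_int M (\<lambda>x. c * f x)"
    and "nsq M (\<lambda>x. c * f x) = (cmod c)\<^sup>2 * nsq M f"
  using assms by (auto simp: sq_int_def nsq_def norm_mult power_mult_distrib)

lemma sq_int_norm_mult_integrable:
  assumes f: "sq_int M f" and g: "sq_int M g"
  shows "integrable M (\<lambda>x. cmod (f x) * cmod (g x))"
proof -
  have [measurable]: "f \<in> borel_measurable M" "g \<in> borel_measurable M"
    using f g by (auto simp: sq_int_def)
  have "integrable M (\<lambda>x. (cmod (f x))\<^sup>2 + (cmod (g x))\<^sup>2)"
    using f g by (auto simp: sq_int_def)
  then show ?thesis
  proof (rule Bochner_Integration.integrable_bound, goal_cases)
    case 2
    have "cmod (f x) * cmod (g x) \<le> (cmod (f x))\<^sup>2 + (cmod (g x))\<^sup>2" for x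
      using zero_le_power2[of "cmod (f x) - cmod (g x)"]
        mult_nonneg_nonneg[of "cmod (f x)" "cmod (g x)"]
      by (simp add: power2_eq_square algebra_simps del: mult_nonneg_nonneg)
    then show ?case by (auto simp: abs_mult)
  qed measurable
qed

text \<open>Discriminant argument for the moduli of f and g, which keeps the quadratic real; the
  complex integral is then bounded by the integral of the moduli.\<close>

lemma Cauchy_Schwarz_sq_int:
  assumes f: "sq_int M f" and g: "sq_int M g"
  shows "(cmod (\<integral>x. f x * cnj (g x) \<partial>M))\<^sup>2 \<le> nsq M f * nsq M g"
proof -
  define b where "b = (\<integral>x. cmod (f x) * cmod (g x) \<partial>M)"
  note ifg = sq_int_norm_mult_integrable[OF f g]
  have q: "0 \<le> nsq M f - 2 * t * b + t\<^sup>2 * nsq M g" for t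
  proof -
    have "0 \<le> (\<integral>x. (cmod (f x) - t * cmod (g x))\<^sup>2 \<partial>M)" by simp
    also have "\<dots> = (\<integral>x. (cmod (f x))\<^sup>2 - 2 * t * (cmod (f x) * cmod (g x)) + t\<^sup>2 * (cmod (g x))\<^sup>2 \<partial>M)"
      by (simp add: power2_eq_square algebra_simps)
    also have "\<dots> = nsq M f - 2 * t * b + t\<^sup>2 * nsq M g"
      using f g ifg by (simp add: sq_int_def nsq_def b_def)
    finally show ?thesis .
  qed
  have "b\<^sup>2 \<le> nsq M f * nsq M g"
  proof (cases "nsq M g = 0")
    case True
    have "b = 0"
    proof (rule ccontr)
      assume "b \<noteq> 0"
      then show False
        \<comment> \<open>Without the quadratic term the expression is affine in t, and this t makes
          it equal to -1.\<close>
        using q[of "(nsq M f + 1) / (2 * b)"] True by (simp add: field_simps)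
    qed
    then show ?thesis using True by simp
  next
    case False
    then have "nsq M g > 0" using nsq_nonneg[of M g] by simp
    then show ?thesis
      \<comment> \<open>The minimiser of the quadratic.\<close>
      using q[of "b / nsq M g"] by (simp add: field_simps power2_eq_square)
  qed
  moreover have "cmod (\<integral>x. f x * cnj (g x) \<partial>M) \<le> b"
    unfolding b_def using integral_norm_bound[of M "\<lambda>x. f x * cnj (g x)"] by (simp add: norm_mult)
  then have "(cmod (\<integral>x. f x * cnj (g x) \<partial>M))\<^sup>2 \<le> b\<^sup>2"
    by (intro power_mono) auto
  ultimately show ?thesis by linarith
qed

lemma (in finite_measure) sq_int_bounded:
  assumes "g \<in> borel_measurable M" "\<And>x. cmod (g x) \<le> C"
  shows "sq_int M g"
proof -
  have "sq_int M (\<lambda>x. 1)" by (simp add: sq_int_def)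
  then show ?thesis by (rule sq_int_dominated[where C=C]) (use assms in auto)
qed

text \<open>Cauchy-Schwarz against the constant 1, which has norm one in a probability
  space.\<close>

lemma (in prob_space) nsq_expectation:
  assumes f: "sq_int M f"
  shows "integrable M f" "(cmod (\<integral>x. f x \<partial>M))\<^sup>2 \<le> nsq M f"
proof -
  have 1: "sq_int M (\<lambda>x. 1)" by (rule sq_int_bounded[where C=1]) auto
  have "integrable M (\<lambda>x. cmod (f x))" using sq_int_norm_mult_integrable[OF f 1] by simp
  then show "integrable M f" using f by (simp add: sq_int_def integrable_norm_iff)
  have "nsq M (\<lambda>x. 1) = 1" by (simp add: nsq_def prob_space)
  then show "(cmod (\<integral>x. f x \<partial>M))\<^sup>2 \<le> nsq M f"
    using Cauchy_Schwarz_sq_int[OF f 1] by simp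
qed

lemma nsq_shrinking_tendsto_0:
  assumes f: "sq_int M f" and S: "\<And>n. S n \<in> sets M"
    and ev: "AE x in M. eventually (\<lambda>n. x \<notin> S n) sequentially"
  shows "(\<lambda>n. nsq M (\<lambda>x. indicator (S n) x * f x)) \<longlonglongrightarrow> 0"
proof -
  have [measurable]: "f \<in> borel_measurable M" using f by (simp add: sq_int_def)
  note S[measurable]
  have "(\<lambda>n. \<integral>x. (cmod (indicator (S n) x * f x))\<^sup>2 \<partial>M) \<longlonglongrightarrow> (\<integral>x. 0 \<partial>M)"
  proof (rule integral_dominated_convergence[where w="\<lambda>x. (cmod (f x))\<^sup>2"])
    show "AE x in M. (\<lambda>n. (cmod (indicator (S n) x * f x))\<^sup>2) \<longlonglongrightarrow> 0"
      using ev
    proof eventually_elim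
      case (elim x)
      then have "eventually (\<lambda>n. (cmod (indicator (S n) x * f x))\<^sup>2 = 0) sequentially"
        by eventually_elim simp
      then show ?case by (rule tendsto_eventually)
    qed
  qed (use f in \<open>auto simp: sq_int_def indicator_def\<close>)
  then show ?thesis by (simp add: nsq_def)
qed

text \<open>\<open>f n\<close> sees only the part of g on \<open>S n\<close>, and the norm of that
  part tends to zero. This makes concentrating unit vectors weakly null without any
  orthogonality.\<close>

lemma inner_shrinking_tendsto_0:
  assumes f: "\<And>n. sq_int M (f n)" and f1: "\<And>n. nsq M (f n) \<le> 1"
    and f0: "\<And>n x. x \<notin> S n \<Longrightarrow> f n x = 0"
    and S: "\<And>n. S n \<in> sets M"
    and ev: "AE x in M. eventually (\<lambda>n. x \<notin> S n) sequentially"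
    and g: "sq_int M g"
  shows "(\<lambda>n. \<integral>x. f n x * cnj (g x) \<partial>M) \<longlonglongrightarrow> 0"
proof -
  have [measurable]: "g \<in> borel_measurable M" using g by (simp add: sq_int_def)
  note S[measurable]
  have gS: "sq_int M (\<lambda>x. indicator (S n) x * g x)" for n
    by (rule sq_int_dominated[OF g, where C=1]) (auto simp: indicator_def)
  have eq: "f n x * cnj (g x) = f n x * cnj (indicator (S n) x * g x)" for n x
    using f0[of x n] by (cases "x \<in> S n") auto
  have le: "(cmod (\<integral>x. f n x * cnj (g x) \<partial>M))\<^sup>2 \<le> nsq M (\<lambda>x. indicator (S n) x * g x)" for n
  proof -
    have "(cmod (\<integral>x. f n x * cnj (g x) \<partial>M))\<^sup>2 \<le> nsq M (f n) * nsq M (\<lambda>x. indicator (S n) x * g x)"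
      unfolding eq by (rule Cauchy_Schwarz_sq_int[OF f gS])
    also have "\<dots> \<le> 1 * nsq M (\<lambda>x. indicator (S n) x * g x)"
      by (intro mult_right_mono f1 nsq_nonneg)
    finally show ?thesis by simp
  qed
  have "(\<lambda>n. (cmod (\<integral>x. f n x * cnj (g x) \<partial>M))\<^sup>2) \<longlonglongrightarrow> 0"
    by (rule tendsto_sandwich[OF _ _ tendsto_const nsq_shrinking_tendsto_0[OF g S ev]])
       (use le in auto)
  then have "(\<lambda>n. sqrt ((cmod (\<integral>x. f n x * cnj (g x) \<partial>M))\<^sup>2)) \<longlonglongrightarrow> sqrt 0"
    by (rule tendsto_real_sqrt)
  then show ?thesis by (simp add: tendsto_norm_zero_iff)
qed

section \<open>Marginals and partial integrals on products of probability spaces\<close>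

lemma distr_pair_fst_prob:
  assumes "prob_space M" "prob_space N"
  shows "distr (M \<Otimes>\<^sub>M N) M fst = M"
proof (rule measure_eqI)
  interpret M: prob_space M by fact
  interpret N: prob_space N by fact
  fix A assume A: "A \<in> sets (distr (M \<Otimes>\<^sub>M N) M fst)"
  then have "A \<subseteq> space M" using sets.sets_into_space by auto
  then have "fst -` A \<inter> space (M \<Otimes>\<^sub>M N) = A \<times> space N"
    by (auto simp: space_pair_measure)
  then show "emeasure (distr (M \<Otimes>\<^sub>M N) M fst) A = emeasure M A"
    using A by (simp add: emeasure_distr N.emeasure_pair_measure_Times N.emeasure_space_1)
qed auto

lemma distr_pair_snd_prob:
  assumes "prob_space M" "prob_space N"
  shows "distr (M \<Otimes>\<^sub>M N) N snd = N"
proof (rule measure_eqI)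
  interpret M: prob_space M by fact
  interpret N: prob_space N by fact
  fix A assume A: "A \<in> sets (distr (M \<Otimes>\<^sub>M N) N snd)"
  then have "A \<subseteq> space N" using sets.sets_into_space by auto
  then have "snd -` A \<inter> space (M \<Otimes>\<^sub>M N) = space M \<times> A"
    by (auto simp: space_pair_measure)
  then show "emeasure (distr (M \<Otimes>\<^sub>M N) N snd) A = emeasure N A"
    using A by (simp add: emeasure_distr N.emeasure_pair_measure_Times M.emeasure_space_1)
qed auto

lemma AE_pair_fst_snd:
  assumes "prob_space M" "prob_space N"
  shows "(AE x in M. P x) \<Longrightarrow> AE x in M \<Otimes>\<^sub>M N. P (fst x)"
    and "(AE x in N. Q x) \<Longrightarrow> AE x in M \<Otimes>\<^sub>M N. Q (snd x)"
  by (rule AE_distrD[OF measurable_fst[of M N], unfolded distr_pair_fst_prob[OF assms]], assumption,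
      rule AE_distrD[OF measurable_snd[of M N], unfolded distr_pair_snd_prob[OF assms]], assumption)

lemma nsq_pair_fst_snd:
  assumes MN: "prob_space M" "prob_space N"
  shows "sq_int M f \<Longrightarrow> sq_int (M \<Otimes>\<^sub>M N) (\<lambda>x. f (fst x)) \<and> nsq (M \<Otimes>\<^sub>M N) (\<lambda>x. f (fst x)) = nsq M f"
    and "sq_int N g \<Longrightarrow> sq_int (M \<Otimes>\<^sub>M N) (\<lambda>x. g (snd x)) \<and> nsq (M \<Otimes>\<^sub>M N) (\<lambda>x. g (snd x)) = nsq N g"
proof -
  assume f: "sq_int M f"
  then have [measurable]: "f \<in> borel_measurable M" by (simp add: sq_int_def)
  show "sq_int (M \<Otimes>\<^sub>M N) (\<lambda>x. f (fst x)) \<and> nsq (M \<Otimes>\<^sub>M N) (\<lambda>x. f (fst x)) = nsq M f"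
    using integrable_distr_eq[of fst "M \<Otimes>\<^sub>M N" M "\<lambda>x. (cmod (f x))\<^sup>2"] f
      integral_distr[of fst "M \<Otimes>\<^sub>M N" M "\<lambda>x. (cmod (f x))\<^sup>2"]
    by (simp add: sq_int_def nsq_def distr_pair_fst_prob[OF MN])
next
  assume g: "sq_int N g"
  then have [measurable]: "g \<in> borel_measurable N" by (simp add: sq_int_def)
  show "sq_int (M \<Otimes>\<^sub>M N) (\<lambda>x. g (snd x)) \<and> nsq (M \<Otimes>\<^sub>M N) (\<lambda>x. g (snd x)) = nsq N g"
    using integrable_distr_eq[of snd "M \<Otimes>\<^sub>M N" N "\<lambda>x. (cmod (g x))\<^sup>2"] g
      integral_distr[of snd "M \<Otimes>\<^sub>M N" N "\<lambda>x. (cmod (g x))\<^sup>2"]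
    by (simp add: sq_int_def nsq_def distr_pair_snd_prob[OF MN])
qed

text \<open>Cauchy-Schwarz on almost every section, then Fubini. With both factors equal to
  \<open>T3\<close> this is the boundedness of the off-diagonal entry A_12.\<close>

lemma nsq_partial_integral:
  assumes MN: "prob_space M" "prob_space N" and g: "sq_int (M \<Otimes>\<^sub>M N) g"
  shows sq_int_partial_integral: "sq_int M (\<lambda>x. \<integral>y. g (x, y) \<partial>N)"
    and "nsq M (\<lambda>x. \<integral>y. g (x, y) \<partial>N) \<le> nsq (M \<Otimes>\<^sub>M N) g"
    and AE_sq_int_section: "AE x in M. sq_int N (\<lambda>y. g (x, y))"
proof -
  interpret M: prob_space M by fact
  interpret N: prob_space N by fact
  interpret pair_sigma_finite M N ..
  have [measurable]: "g \<in> borel_measurable (M \<Otimes>\<^sub>M N)" using g by (simp add: sq_int_def)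
  have ig: "integrable (M \<Otimes>\<^sub>M N) (\<lambda>x. (cmod (g x))\<^sup>2)" using g by (simp add: sq_int_def)
  have m: "(\<lambda>x. \<integral>y. g (x, y) \<partial>N) \<in> borel_measurable M" by measurable
  show ae: "AE x in M. sq_int N (\<lambda>y. g (x, y))"
    using AE_integrable_fst'[OF ig] AE_space
    by eventually_elim (auto simp: sq_int_def)
  have le: "AE x in M. (cmod (\<integral>y. g (x, y) \<partial>N))\<^sup>2 \<le> (\<integral>y. (cmod (g (x, y)))\<^sup>2 \<partial>N)"
    using ae by eventually_elim (use N.nsq_expectation(2) in \<open>auto simp: nsq_def\<close>)
  have i1: "integrable M (\<lambda>x. \<integral>y. (cmod (g (x, y)))\<^sup>2 \<partial>N)"
    by (rule integrable_fst'[OF ig])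
  have i2: "integrable M (\<lambda>x. (cmod (\<integral>y. g (x, y) \<partial>N))\<^sup>2)"
    by (rule Bochner_Integration.integrable_bound[OF i1]) (use le m in auto)
  then show "sq_int M (\<lambda>x. \<integral>y. g (x, y) \<partial>N)" using m by (simp add: sq_int_def)
  show "nsq M (\<lambda>x. \<integral>y. g (x, y) \<partial>N) \<le> nsq (M \<Otimes>\<^sub>M N) g"
    unfolding nsq_def integral_fst'[OF ig, symmetric]
    by (rule integral_mono_AE[OF i2 i1 le])
qed

section \<open>The torus and the dispersion functions\<close>

definition Tcl :: "(real^3) set" where
  "Tcl = cbox (\<chi> i. - pi) (\<chi> i. pi)"

lemma Tcl_iff: "x \<in> Tcl \<longleftrightarrow> (\<forall>i. \<bar>x $ i\<bar> \<le> pi)"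
  by (auto simp: Tcl_def mem_box_cart abs_le_iff) (metis minus_le_iff)+

lemma Tbox_subset_Tcl: "Tbox \<subseteq> Tcl"
  by (auto simp: Tbox_def Tcl_def mem_box_cart less_imp_le)

lemma box_subset_Tbox: "box (\<chi> i. - pi) (\<chi> i. pi) \<subseteq> Tbox"
  by (auto simp: Tbox_def mem_box_cart less_imp_le)

lemma Tbox_borel [measurable]: "Tbox \<in> sets borel"
  unfolding Tbox_def by measurable

lemma emeasure_lborel_cube_pos: "emeasure lborel (box (\<chi> i. - pi) (\<chi> i. pi) :: (real^3) set) > 0"
proof -
  have "0 < (\<Prod>b\<in>(Basis :: (real^3) set). ((\<chi> i. pi) - (\<chi> i. - pi)) \<bullet> b)"
    by (rule prod_pos) (auto simp: Basis_vec_def inner_axis)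
  then show ?thesis by (auto simp: emeasure_lborel_box_eq Basis_vec_def inner_axis)
qed

lemma emeasure_lborel_Tbox: "emeasure lborel Tbox \<noteq> 0" "emeasure lborel Tbox < \<infinity>"
proof -
  show "emeasure lborel Tbox \<noteq> 0"
    using emeasure_mono[OF box_subset_Tbox, of lborel] emeasure_lborel_cube_pos by auto
  have "emeasure lborel Tbox \<le> emeasure lborel Tcl"
    by (rule emeasure_mono[OF Tbox_subset_Tcl]) (simp add: Tcl_def)
  also have "\<dots> < \<infinity>" unfolding Tcl_def by (rule emeasure_lborel_cbox_finite)
  finally show "emeasure lborel Tbox < \<infinity>" .
qed

lemma AE_Tcl_Tbox: "AE x in lborel. x \<in> Tcl \<longrightarrow> x \<in> Tbox"
proof -
  let ?b = "box (\<chi> i. - pi) (\<chi> i. pi) :: (real^3) set"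
  have sub: "?b \<subseteq> Tcl" unfolding Tcl_def by (rule box_subset_cbox)
  have "emeasure lborel (Tcl - ?b) = emeasure lborel Tcl - emeasure lborel ?b"
    by (rule emeasure_Diff) (use sub in \<open>auto simp: Tcl_def emeasure_lborel_box_eq\<close>)
  also have "emeasure lborel Tcl = emeasure lborel ?b"
    by (simp add: Tcl_def emeasure_lborel_box_eq emeasure_lborel_cbox_eq)
  finally have "emeasure lborel (Tcl - ?b) = 0"
    by (simp add: emeasure_lborel_box_eq)
  then have "Tcl - ?b \<in> null_sets lborel"
    by (auto simp: null_sets_def Tcl_def)
  then have "AE x in lborel. x \<notin> Tcl - ?b" by (rule AE_not_in)
  then show ?thesis by eventually_elim (use box_subset_Tbox in auto)
qed

lemma prob_space_T3: "prob_space T3"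
  unfolding T3_def by (rule prob_space_uniform_measure) (use emeasure_lborel_Tbox in auto)

interpretation T3: prob_space T3 by (rule prob_space_T3)

interpretation TT: pair_prob_space T3 T3 ..

lemma space_T3 [simp]: "space T3 = UNIV" by (simp add: T3_def)

lemma measure_T3_UNIV [simp]: "measure T3 UNIV = 1"
  using T3.prob_space by simp

lemma sets_T3 [simp, measurable_cong]: "sets T3 = sets borel"
  by (simp add: T3_def)

lemma AE_T3_iff: "(AE x in T3. P x) \<longleftrightarrow> (AE x in lborel. x \<in> Tbox \<longrightarrow> P x)"
  unfolding T3_def using emeasure_lborel_Tbox by (intro AE_uniform_measure) auto

lemma AE_T3_Tbox: "AE x in T3. x \<in> Tbox"
  by (simp add: AE_T3_iff)

lemma AE_T3_neq: "AE x in T3. x \<noteq> k"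
  unfolding AE_T3_iff using AE_lborel_singleton[of k] by eventually_elim auto

text \<open>The half-open \<open>Tbox\<close> is not invariant under sign changes of coordinates,
  whereas \<open>Tcl\<close> is. Passing to Lebesgue measure on the cube prepares the change of
  variables in \<open>Ik_reflect\<close>.\<close>

lemma integral_T3_Tcl:
  fixes f :: "real^3 \<Rightarrow> real"
  assumes [measurable]: "f \<in> borel_measurable borel"
  shows "(\<integral>t. f t \<partial>T3) = (\<integral>t. indicator Tcl t * f t \<partial>lborel) / measure lborel Tbox"
proof -
  define c where "c = measure lborel Tbox"
  have c: "emeasure lborel Tbox = ennreal c"
    unfolding c_def by (rule emeasure_eq_ennreal_measure) (use emeasure_lborel_Tbox in auto)
  have c0: "c > 0"
    using emeasure_lborel_Tbox(1) unfolding c by (simp add: ennreal_eq_0_iff)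
  have "T3 = density lborel (\<lambda>x. ennreal (indicator Tbox x / c))"
    unfolding T3_def uniform_measure_def c
    using c0 by (intro density_cong) (auto simp: indicator_def divide_ennreal[of 1, simplified])
  then have "(\<integral>t. f t \<partial>T3) = (\<integral>t. f t \<partial>density lborel (\<lambda>x. ennreal (indicator Tbox x / c)))"
    by (rule arg_cong)
  also have "\<dots> = (\<integral>t. (indicator Tbox t / c) *\<^sub>R f t \<partial>lborel)"
    by (rule integral_density) (use c0 in auto)
  also have "\<dots> = (\<integral>t. (indicator Tcl t * f t) / c \<partial>lborel)"
  proof (rule integral_cong_AE)
    show "AE t in lborel. (indicator Tbox t / c) *\<^sub>R f t = indicator Tcl t * f t / c"
      using AE_Tcl_Tbox by eventually_elim (use Tbox_subset_Tcl in \<open>auto simp: indicator_def\<close>)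
  qed (auto simp: Tcl_def)
  finally show ?thesis by (simp add: c_def)
qed

lemma eps_bounds: "0 \<le> eps k" "eps k \<le> 6"
proof -
  show "0 \<le> eps k" unfolding eps_def by (intro sum_nonneg) simp
  have "eps k \<le> (\<Sum>i\<in>(UNIV::3 set). 2)"
    unfolding eps_def by (intro sum_mono) (use cos_ge_minus_one in \<open>smt (verit)\<close>)
  then show "eps k \<le> 6" by simp
qed

lemma w2_bounds: "0 \<le> w2 k p" "w2 k p \<le> 18"
  using eps_bounds[of k] eps_bounds[of p] eps_bounds[of "(1/2) *\<^sub>R (k + p)"]
  unfolding w2_def by linarith+

lemma w2_commute: "w2 k p = w2 p k"
  by (simp add: w2_def add.commute)

lemma continuous_w1: "continuous_on UNIV (w1 \<gamma>)"
  unfolding w1_def eps_def by (intro continuous_intros)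

lemma continuous_w2: "continuous_on UNIV (\<lambda>x. w2 (fst x) (snd x))"
  unfolding w2_def eps_def by (intro continuous_intros)

lemma borel_measurable_w1 [measurable]: "w1 \<gamma> \<in> borel_measurable borel"
  by (rule borel_measurable_continuous_onI[OF continuous_w1])

lemma borel_measurable_w2 [measurable]:
  "(\<lambda>x. w2 (fst x) (snd x)) \<in> borel_measurable (borel \<Otimes>\<^sub>M borel)"
  unfolding borel_prod by (rule borel_measurable_continuous_onI[OF continuous_w2])

lemma borel_measurable_w2_comp [measurable]:
  assumes "f \<in> borel_measurable M" "g \<in> borel_measurable M"
  shows "(\<lambda>x. w2 (f x) (g x)) \<in> borel_measurable M"
  using measurable_compose[OF measurable_Pair[OF assms] borel_measurable_w2] by simp

section \<open>Symmetry under reflection of coordinates\<close>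

lemma eps_reflect:
  assumes "\<And>i. s $ i = 1 \<or> s $ i = (-1::real)"
  shows "eps (\<chi> i. s $ i * k $ i) = eps k"
  unfolding eps_def
proof (rule sum.cong)
  fix i
  show "1 - cos ((\<chi> i. s $ i * k $ i) $ i) = 1 - cos (k $ i)"
    using assms[of i] by auto
qed simp

text \<open>The same signs must act on both arguments, so that the half-sum is reflected with them;
  cosine is even. A shift of one argument by 2 pi would instead reverse the sign of a cosine of the
  half-sum.\<close>

lemma w2_reflect:
  assumes "\<And>i. s $ i = 1 \<or> s $ i = (-1::real)"
  shows "w2 (\<chi> i. s $ i * k $ i) (\<chi> i. s $ i * p $ i) = w2 k p"
proof -
  have "(1/2) *\<^sub>R ((\<chi> i. s $ i * k $ i) + (\<chi> i. s $ i * p $ i)) = (\<chi> i. s $ i * ((1/2) *\<^sub>R (k + p)) $ i)"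
    by (simp add: vec_eq_iff algebra_simps)
  then show ?thesis unfolding w2_def by (simp only: eps_reflect[OF assms])
qed

lemma integral_lborel_reflect:
  fixes f :: "real^3 \<Rightarrow> real"
  assumes s: "\<And>i. s $ i = 1 \<or> s $ i = (-1::real)" and [measurable]: "f \<in> borel_measurable borel"
  shows "(\<integral>t. f (\<chi> i. s $ i * t $ i) \<partial>lborel) = (\<integral>t. f t \<partial>lborel)"
proof -
  \<comment> \<open>The reflection in the form demanded by \<open>lborel_affine_euclidean\<close>:
    zero translation and scaling factor +1 or -1 along each axis, so the density is 1.\<close>
  let ?T = "\<lambda>x::real^3. 0 + (\<Sum>j\<in>Basis. ((s \<bullet> j) * (x \<bullet> j)) *\<^sub>R j)"
  have T: "?T = (\<lambda>x. \<chi> i. s $ i * x $ i)"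
  proof
    fix x :: "real^3"
    have "(\<chi> i. s $ i * x $ i) = (\<Sum>j\<in>Basis. ((\<chi> i. s $ i * x $ i) \<bullet> j) *\<^sub>R j)"
      by (rule euclidean_representation[symmetric])
    also have "\<dots> = (\<Sum>j\<in>Basis. ((s \<bullet> j) * (x \<bullet> j)) *\<^sub>R j)"
      by (rule sum.cong) (auto simp: Basis_vec_def inner_axis)
    finally show "?T x = (\<chi> i. s $ i * x $ i)" by simp
  qed
  have sj: "\<bar>s \<bullet> j\<bar> = 1" if "j \<in> Basis" for j
    using that s by (auto simp: Basis_vec_def inner_axis) (metis abs_1 abs_minus_cancel)
  have "lborel = density (distr lborel borel ?T) (\<lambda>_. (\<Prod>j\<in>Basis. \<bar>s \<bullet> j\<bar>))"
    by (rule lborel_affine_euclidean[where c="\<lambda>j. s \<bullet> j"]) (use sj in force)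
  also have "(\<Prod>j\<in>Basis. \<bar>s \<bullet> j\<bar>) = 1"
    using sj by simp
  finally have lb: "distr lborel borel (\<lambda>x. \<chi> i. s $ i * x $ i) = (lborel :: (real^3) measure)"
    unfolding T by (simp add: density_1)
  have m: "(\<lambda>x::real^3. \<chi> i. s $ i * x $ i) \<in> borel_measurable borel"
    by (intro borel_measurable_continuous_onI continuous_intros)
  show ?thesis
    by (subst (2) lb[symmetric], subst integral_distr) (use m in auto)
qed

lemma Ik_reflect:
  assumes s: "\<And>i. s $ i = 1 \<or> s $ i = (-1::real)"
  shows "Ik (\<chi> i. s $ i * k $ i) z = Ik k z"
proof -
  let ?k = "\<chi> i. s $ i * k $ i" and ?r = "\<lambda>t::real^3. \<chi> i. s $ i * t $ i"
  have [measurable]: "Tcl \<in> sets borel" by (simp add: Tcl_def)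
  have inv: "indicator Tcl (?r t) = (indicator Tcl t :: real)" for t
  proof -
    have "\<bar>s $ i * t $ i\<bar> = \<bar>t $ i\<bar>" for i using s[of i] by auto
    then show ?thesis by (simp add: indicator_def Tcl_iff)
  qed
  have "(\<integral>t. indicator Tcl t * (1 / (w2 ?k t - z)) \<partial>lborel)
      = (\<integral>t. indicator Tcl (?r t) * (1 / (w2 ?k (?r t) - z)) \<partial>lborel)"
    by (rule integral_lborel_reflect[OF s, symmetric]) measurable
  also have "\<dots> = (\<integral>t. indicator Tcl t * (1 / (w2 k t - z)) \<partial>lborel)"
    by (simp add: inv w2_reflect[OF s])
  finally show ?thesis
    unfolding Ik_def by (simp add: integral_T3_Tcl)
qed

lemma Delta_Tcl_Tbox:
  assumes "k \<in> Tcl"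
  shows "\<exists>k'\<in>Tbox. \<forall>z. Delta \<gamma> \<mu> k' z = Delta \<gamma> \<mu> k z"
proof -
  \<comment> \<open>These signs replace each coordinate by its absolute value, which lies in
    [0, pi]; in particular the missing face -pi goes to pi.\<close>
  define s :: "real^3" where "s = (\<chi> i. if k $ i < 0 then -1 else 1)"
  have s: "s $ i = 1 \<or> s $ i = -1" for i by (simp add: s_def)
  have "(\<chi> i. s $ i * k $ i) \<in> Tbox"
    using assms pi_gt_zero by (auto simp: Tbox_def Tcl_iff s_def abs_le_iff)
       (smt (verit, ccfv_SIG) pi_gt_zero)+
  moreover have "Delta \<gamma> \<mu> (\<chi> i. s $ i * k $ i) z = Delta \<gamma> \<mu> k z" for z
    unfolding Delta_def w1_def by (simp add: eps_reflect[OF s] Ik_reflect[OF s])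
  ultimately show ?thesis by blast
qed

section \<open>The structure of the set of zeros\<close>

lemma m_min_eq: "m_min = 0"
  unfolding m_min_def
proof (rule antisym)
  have 0: "(0::real^3) \<in> Tbox" by (simp add: Tbox_def)
  have "(INF x\<in>Tbox \<times> Tbox. w2 (fst x) (snd x)) \<le> w2 (fst (0::real^3, 0::real^3)) (snd (0::real^3, 0::real^3))"
    by (rule cINF_lower) (use 0 w2_bounds in \<open>auto intro!: bdd_belowI[where m=0]\<close>)
  then show "(INF x\<in>Tbox \<times> Tbox. w2 (fst x) (snd x)) \<le> 0" by (simp add: w2_def eps_def)
  show "0 \<le> (INF x\<in>Tbox \<times> Tbox. w2 (fst x) (snd x))"
    by (rule cINF_greatest) (use 0 w2_bounds in auto)
qed

lemma M_max_eq: "M_max = 18"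
  unfolding M_max_def
proof (rule antisym)
  \<comment> \<open>The half-sum of q with itself is q, so all three terms of \<open>w2\<close>
    reach their maximum 6 simultaneously.\<close>
  define q :: "real^3" where "q = (\<chi> i. pi)"
  have q: "q \<in> Tbox" by (simp add: Tbox_def q_def)
  have "w2 (fst (q, q)) (snd (q, q)) \<le> (SUP x\<in>Tbox \<times> Tbox. w2 (fst x) (snd x))"
    by (rule cSUP_upper) (use q w2_bounds in \<open>auto intro!: bdd_aboveI[where M=18]\<close>)
  moreover have "(1/2) *\<^sub>R (q + q) = q" by (simp add: vec_eq_iff)
  moreover have "eps q = 6" by (simp add: eps_def q_def)
  ultimately show "18 \<le> (SUP x\<in>Tbox \<times> Tbox. w2 (fst x) (snd x))" by (simp add: w2_def)
  show "(SUP x\<in>Tbox \<times> Tbox. w2 (fst x) (snd x)) \<le> 18"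
    by (rule cSUP_least) (use q w2_bounds in auto)
qed

lemma mk_nonneg: "0 \<le> mk k" and Mk_le: "Mk k \<le> 18"
proof -
  have 0: "(0::real^3) \<in> Tbox" by (simp add: Tbox_def)
  show "0 \<le> mk k" unfolding mk_def by (rule cINF_greatest) (use 0 w2_bounds in auto)
  show "Mk k \<le> 18" unfolding Mk_def by (rule cSUP_least) (use 0 w2_bounds in auto)
qed

text \<open>Every fibre interval \<open>[mk k, Mk k]\<close> lies in [0, 18], so outside [0, 18] the
  exclusion in \<open>disc_spec_k\<close> is automatic. Reflection allows the compact
  \<open>Tcl\<close> in place of \<open>Tbox\<close>.\<close>

lemma Sigma_mu_iff:
  "z \<in> Sigma_mu \<gamma> \<mu> \<longleftrightarrow> (\<exists>k\<in>Tcl. Delta \<gamma> \<mu> k z = 0)" if "z \<notin> {0..18}" for z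
proof -
  have "z \<notin> {mk k..Mk k}" for k
    using that mk_nonneg[of k] Mk_le[of k] by auto
  then show ?thesis
    using that Delta_Tcl_Tbox[of _ \<gamma> \<mu>] Tbox_subset_Tcl
    unfolding Sigma_mu_def Lambda_def disc_spec_k_def m_min_eq M_max_eq
    by (auto; metis subsetD)
qed

lemma interval_subset_Sigma_mu: "{0..18} \<subseteq> Sigma_mu \<gamma> \<mu>"
  by (simp add: Sigma_mu_def m_min_eq M_max_eq)

text \<open>Distance at least e from [0, 18]. For e > 0 this makes the bound 1/e on the resolvent
  kernel uniform in k, t and z, and unlike the complement of [0, 18] the set is closed, so
  compactness applies.\<close>

definition away :: "real \<Rightarrow> real set" where
  "away e = {z. \<forall>x\<in>{0..18}. e \<le> \<bar>x - z\<bar>}"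

lemma closed_away: "closed (away e)"
proof -
  have "away e = (\<Inter>x\<in>{0..18}. {z. e \<le> \<bar>x - z\<bar>})" by (auto simp: away_def)
  moreover have "closed \<dots>" by (intro closed_INT ballI closed_Collect_le continuous_intros)
  ultimately show ?thesis by simp
qed

lemma away_obtain:
  assumes "z \<notin> {0..18}"
  obtains e where "e > 0" "z \<in> away e"
proof -
  have "\<exists>d>0. \<forall>x\<in>{0..18}. d \<le> dist z x"
    by (rule separate_point_closed) (use assms in auto)
  then show ?thesis using that by (force simp: away_def dist_real_def abs_minus_commute)
qed

lemma away_notin: "e > 0 \<Longrightarrow> z \<in> away e \<Longrightarrow> z \<notin> {0..18}"
  by (force simp: away_def)

lemma away_w2: "z \<in> away e \<Longrightarrow> e \<le> \<bar>w2 k p - z\<bar>"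
  using w2_bounds[of k p] by (auto simp: away_def)

lemma abs_inverse_w2_le:
  assumes "e > 0" "z \<in> away e"
  shows "\<bar>1 / (w2 k t - z)\<bar> \<le> 1 / e"
  using away_w2[OF assms(2), of k t] assms(1) by (auto simp: abs_divide intro!: divide_left_mono mult_pos_pos)

lemma integrable_inverse_w2:
  assumes "z \<notin> {0..18}"
  shows "integrable T3 (\<lambda>t. 1 / (w2 k t - z))"
proof -
  obtain e where "e > 0" "z \<in> away e" using away_obtain assms by blast
  then show ?thesis
    by (intro T3.integrable_const_bound[where B="1/e"]) (use abs_inverse_w2_le in auto)
qed

lemma abs_Ik_le:
  assumes e: "e > 0" "z \<in> away e"
  shows "\<bar>Ik k z\<bar> \<le> 1 / e"
proof -
  have "\<bar>Ik k z\<bar> \<le> (\<integral>t. \<bar>1 / (w2 k t - z)\<bar> \<partial>T3)"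
    unfolding Ik_def by (rule integral_abs_bound)
  also have "\<dots> \<le> (\<integral>t. 1 / e \<partial>T3)"
    using integrable_norm[OF integrable_inverse_w2[OF away_notin[OF e]]] abs_inverse_w2_le[OF e]
    by (intro integral_mono) auto
  finally show ?thesis by simp
qed

lemma tendsto_w2:
  assumes "(f \<longlongrightarrow> k) F" "(g \<longlongrightarrow> p) F"
  shows "((\<lambda>x. w2 (f x) (g x)) \<longlongrightarrow> w2 k p) F"
  using continuous_on_tendsto_compose[OF continuous_w2 tendsto_Pair[OF assms]] by simp

text \<open>Dominated convergence with the constant majorant 1/e. Continuity in k and z jointly is
  what the closedness of the zero set requires.\<close>

lemma continuous_on_Ik:
  assumes e: "e > 0"
  shows "continuous_on (UNIV \<times> away e) (\<lambda>x. Ik (fst x) (snd x))"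
  unfolding continuous_on_sequentially
proof (intro allI ballI impI, elim conjE)
  fix x :: "nat \<Rightarrow> (real^3) \<times> real" and a
  assume x: "\<forall>n. x n \<in> UNIV \<times> away e" and a: "a \<in> UNIV \<times> away e" and lim: "x \<longlonglongrightarrow> a"
  have l: "(\<lambda>n. fst (x n)) \<longlonglongrightarrow> fst a" "(\<lambda>n. snd (x n)) \<longlonglongrightarrow> snd a"
    using lim by (auto intro: tendsto_fst tendsto_snd)
  have xa: "snd (x n) \<in> away e" for n using x by (auto simp: mem_Times_iff)
  have aa: "snd a \<in> away e" using a by (auto simp: mem_Times_iff)
  have "(\<lambda>n. Ik (fst (x n)) (snd (x n))) \<longlonglongrightarrow> Ik (fst a) (snd a)"
    unfolding Ik_def
  proof (rule integral_dominated_convergence[where w="\<lambda>_. 1 / e"])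
    show "AE t in T3. (\<lambda>n. 1 / (w2 (fst (x n)) t - snd (x n))) \<longlonglongrightarrow> 1 / (w2 (fst a) t - snd a)"
    proof (rule AE_I2)
      fix t
      have "w2 (fst a) t - snd a \<noteq> 0" using away_w2[OF aa, of "fst a" t] e by auto
      then show "(\<lambda>n. 1 / (w2 (fst (x n)) t - snd (x n))) \<longlonglongrightarrow> 1 / (w2 (fst a) t - snd a)"
        by (intro tendsto_intros tendsto_w2 l)
    qed
    show "AE t in T3. norm (1 / (w2 (fst (x n)) t - snd (x n))) \<le> 1 / e" for n
      using abs_inverse_w2_le[OF e xa] by auto
  qed auto
  then show "((\<lambda>x. Ik (fst x) (snd x)) \<circ> x) \<longlonglongrightarrow> Ik (fst a) (snd a)"
    by (simp add: comp_def)
qed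

lemma continuous_on_Delta:
  assumes "e > 0"
  shows "continuous_on (UNIV \<times> away e) (\<lambda>x. Delta \<gamma> \<mu> (fst x) (snd x))"
  unfolding Delta_def
  by (intro continuous_intros continuous_on_compose2[OF continuous_w1] continuous_on_Ik assms) auto

lemma continuous_on_Delta_fst:
  assumes "z \<notin> {0..18}"
  shows "continuous_on S (\<lambda>k. Delta \<gamma> \<mu> k z)"
proof -
  obtain e where e: "e > 0" "z \<in> away e" using away_obtain assms by blast
  have "continuous_on S (\<lambda>k. Delta \<gamma> \<mu> (fst (k, z)) (snd (k, z)))"
    by (rule continuous_on_compose2[OF continuous_on_Delta[OF e(1)]])
       (use e in \<open>auto intro!: continuous_intros\<close>)
  then show ?thesis by simp
qed

text \<open>On an interval that misses [0, 18] the difference \<open>w2 - z\<close> keeps its sign,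
  so \<open>1 / (w2 - z)\<close> increases with z and the integral term of \<Delta> does not
  increase; the term \<open>-z\<close> makes the decrease strict.\<close>

lemma Delta_strict_antimono:
  assumes "z1 < z2" "{z1..z2} \<inter> {0..18} = {}"
  shows "Delta \<gamma> \<mu> k z2 < Delta \<gamma> \<mu> k z1"
proof -
  have n: "z1 \<notin> {0..18}" "z2 \<notin> {0..18}" using assms by auto
  have "1 / (w2 k t - z1) \<le> 1 / (w2 k t - z2)" for t
  proof -
    have "w2 k t < z1 \<or> z2 < w2 k t" using assms w2_bounds[of k t] by force
    then show ?thesis
    proof
      assume "w2 k t < z1"
      then show ?thesis using assms(1) by (simp add: divide_simps)
    next
      assume "z2 < w2 k t"
      then show ?thesis using assms(1) by (simp add: divide_simps)
    qed
  qed
  then have "Ik k z1 \<le> Ik k z2"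
    unfolding Ik_def by (intro integral_mono integrable_inverse_w2 n)
  then have "(\<mu>\<^sup>2 / 2) * Ik k z1 \<le> (\<mu>\<^sup>2 / 2) * Ik k z2"
    by (intro mult_left_mono) auto
  then show ?thesis unfolding Delta_def using assms(1) by linarith
qed

section \<open>Zeros over the closed cube: interval structure, boundedness, closedness\<close>

lemma Tcl_compact: "compact Tcl" and Tcl_connected: "connected Tcl"
  unfolding Tcl_def by (auto intro: convex_connected)

lemma zeros_Delta_convex:
  assumes 1: "k1 \<in> Tcl" "Delta \<gamma> \<mu> k1 z1 = 0" and 2: "k2 \<in> Tcl" "Delta \<gamma> \<mu> k2 z2 = 0"
    and z: "z1 \<le> z" "z \<le> z2" and d: "{z1..z2} \<inter> {0..18} = {}"
  shows "\<exists>k\<in>Tcl. Delta \<gamma> \<mu> k z = 0"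
proof -
  consider "z = z1" | "z = z2" | "z1 < z" "z < z2" using z by linarith
  then show ?thesis
  proof cases
    case 3
    have zn: "z \<notin> {0..18}" using z d by auto
    have "{z1..z} \<inter> {0..18} = {}" "{z..z2} \<inter> {0..18} = {}" using z d by auto
    \<comment> \<open>Monotonicity in z moves the zeros at z1 and z2 to opposite signs at the common
      value z; the intermediate value theorem over the cube then produces a zero in k.\<close>
    then have "Delta \<gamma> \<mu> k1 z < 0" "0 < Delta \<gamma> \<mu> k2 z"
      using Delta_strict_antimono[of z1 z \<gamma> \<mu> k1] Delta_strict_antimono[of z z2 \<gamma> \<mu> k2] 1(2) 2(2) 3
      by linarith+
    moreover have "connected ((\<lambda>k. Delta \<gamma> \<mu> k z) ` Tcl)"
      by (rule connected_continuous_image[OF continuous_on_Delta_fst[OF zn] Tcl_connected])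
    ultimately have "0 \<in> (\<lambda>k. Delta \<gamma> \<mu> k z) ` Tcl"
      by (meson connectedD_interval imageI less_imp_le 1(1) 2(1))
    then obtain k where "k \<in> Tcl" "Delta \<gamma> \<mu> k z = 0" by (metis imageE)
    then show ?thesis by blast
  qed (use 1 2 in auto)
qed

text \<open>At distance at least 1 from [0, 18] the integral is at most 1 in modulus, so solving
  \<Delta> = 0 for z gives the bound 6 + |gamma| + mu^2 / 2. The constant 25 also covers
  [-1, 19].\<close>

lemma Sigma_mu_bounded:
  assumes "z \<in> Sigma_mu \<gamma> \<mu>"
  shows "\<bar>z\<bar> \<le> 25 + \<bar>\<gamma>\<bar> + \<mu>\<^sup>2 / 2"
proof (cases "z \<in> {-1..19}")
  case True
  then show ?thesis by (auto simp: abs_le_iff) (smt (verit) divide_nonneg_pos zero_le_power2)+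
next
  case False
  then have n: "z \<notin> {0..18}" by auto
  have a: "z \<in> away 1" using False by (auto simp: away_def)
  obtain k where "Delta \<gamma> \<mu> k z = 0" using assms Sigma_mu_iff[OF n] n by auto
  then have "z = eps k + \<gamma> - (\<mu>\<^sup>2 / 2) * Ik k z" by (simp add: Delta_def w1_def)
  moreover have "\<bar>(\<mu>\<^sup>2 / 2) * Ik k z\<bar> \<le> (\<mu>\<^sup>2 / 2) * 1"
    unfolding abs_mult using abs_Ik_le[OF _ a, of k] by (intro mult_mono) auto
  ultimately show ?thesis using eps_bounds[of k] by linarith
qed

text \<open>Limits of zeros that fall into [0, 18] belong to the set anyway, so only points off
  [0, 18] need a neighbourhood free of zeros.\<close>

lemma closed_Sigma_mu: "closed (Sigma_mu \<gamma> \<mu>)"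
proof -
  define R where "R = 25 + \<bar>\<gamma>\<bar> + \<mu>\<^sup>2 / 2"
  \<comment> \<open>The projection to z of a compact set of pairs (k, z). The cut-off R makes the
    range of z compact and loses no zeros by \<open>Sigma_mu_bounded\<close>.\<close>
  define P where "P e = {z \<in> away e \<inter> {-R..R}. \<exists>k\<in>Tcl. Delta \<gamma> \<mu> k z = 0}" for e
  have P: "closed (P e)" if e: "e > 0" for e
  proof -
    let ?S = "Tcl \<times> (away e \<inter> {-R..R})"
    let ?Z = "?S \<inter> (\<lambda>x. Delta \<gamma> \<mu> (fst x) (snd x)) -` {0}"
    have S: "compact ?S"
      by (intro compact_Times Tcl_compact closed_Int_compact closed_away) auto
    have "closed ?Z"
      by (rule continuous_closed_preimage[OF continuous_on_subset[OF continuous_on_Delta[OF e]]])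
         (use S in \<open>auto intro: compact_imp_closed\<close>)
    then have "compact (?S \<inter> ?Z)" by (rule compact_Int_closed[OF S])
    then have "compact (snd ` (?S \<inter> ?Z))"
      by (rule compact_continuous_image[rotated]) (intro continuous_intros)
    moreover have "snd ` (?S \<inter> ?Z) = P e" by (force simp: P_def)
    ultimately show ?thesis by (simp add: compact_imp_closed)
  qed
  have "\<exists>d>0. ball z d \<subseteq> - Sigma_mu \<gamma> \<mu>" if z: "z \<in> - Sigma_mu \<gamma> \<mu>" for z
  proof -
    have zn: "z \<notin> {0..18}" using z interval_subset_Sigma_mu by blast
    then obtain e where e: "e > 0" "z \<in> away e" using away_obtain by blast
    \<comment> \<open>Halving leaves room: all points within e/2 of z still lie in
      \<open>away (e/2)\<close>.\<close>
    have e2: "e / 2 > 0" using e by simp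
    have "z \<notin> P (e/2)" using z Sigma_mu_iff[OF zn, of \<gamma> \<mu>] by (auto simp: P_def)
    then obtain d where d: "d > 0" "ball z d \<subseteq> - P (e/2)"
      using P[OF e2] by (metis ComplI open_Compl open_contains_ball)
    have "y \<notin> Sigma_mu \<gamma> \<mu>" if y: "y \<in> ball z (min d (e/2))" for y
    proof
      assume yS: "y \<in> Sigma_mu \<gamma> \<mu>"
      have "e / 2 \<le> \<bar>x - y\<bar>" if "x \<in> {0..18}" for x
      proof -
        have "e \<le> \<bar>x - z\<bar>" using e that by (auto simp: away_def)
        moreover have "\<bar>z - y\<bar> < e / 2" using y by (simp add: dist_real_def)
        ultimately show ?thesis by arith
      qed
      then have ya: "y \<in> away (e/2)" by (simp add: away_def)
      then have yn: "y \<notin> {0..18}" by (rule away_notin[OF e2])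
      have "y \<in> P (e/2)" using ya yS Sigma_mu_iff[OF yn] yn Sigma_mu_bounded[OF yS]
        by (auto simp: P_def R_def)
      then show False using d y by auto
    qed
    then show ?thesis using d e2 by (intro exI[of _ "min d (e/2)"]) auto
  qed
  then have "open (- Sigma_mu \<gamma> \<mu>)" by (auto simp: open_contains_ball)
  then show ?thesis by (simp add: closed_def)
qed

text \<open>Applied to the two open half-lines. The zeros in one of them may approach 0 or 18, so
  only the closure is a closed interval; it stays inside the closed set
  \<open>Sigma_mu\<close>.\<close>

lemma Sigma_mu_component_closure:
  assumes U: "is_interval U" "U \<inter> {0..18} = {}"
  shows "\<exists>a b. closure (Sigma_mu \<gamma> \<mu> \<inter> U) = {a..b} \<and> {a..b} \<subseteq> Sigma_mu \<gamma> \<mu>"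
proof -
  let ?G = "Sigma_mu \<gamma> \<mu> \<inter> U"
  have "is_interval ?G"
    unfolding is_interval_1
  proof (intro ballI allI impI)
    fix z1 z2 z assume z: "z1 \<in> ?G" "z2 \<in> ?G" "z1 \<le> z \<and> z \<le> z2"
    have sub: "{z1..z2} \<subseteq> U" using U(1) z by (auto simp: is_interval_1)
    then have d: "{z1..z2} \<inter> {0..18} = {}" using U(2) by blast
    then have n: "z1 \<notin> {0..18}" "z2 \<notin> {0..18}" "z \<notin> {0..18}" using z U(2) by auto
    have "\<exists>k\<in>Tcl. Delta \<gamma> \<mu> k z = 0"
      using z zeros_Delta_convex[OF _ _ _ _ _ _ d, of _ \<gamma> \<mu> _ z]
        Sigma_mu_iff[OF n(1), of \<gamma> \<mu>] Sigma_mu_iff[OF n(2), of \<gamma> \<mu>] n by blast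
    then show "z \<in> ?G" using Sigma_mu_iff[OF n(3)] sub z by auto
  qed
  then have "connected (closure ?G)"
    by (intro connected_imp_connected_closure) (simp add: is_interval_connected_1)
  moreover have "bounded (Sigma_mu \<gamma> \<mu>)"
    unfolding bounded_real using Sigma_mu_bounded by blast
  then have "compact (closure ?G)"
    by (metis bounded_subset compact_closure inf_le1)
  ultimately obtain a b where "closure ?G = {a..b}"
    using connected_compact_interval_1 by blast
  moreover have "closure ?G \<subseteq> Sigma_mu \<gamma> \<mu>"
    by (rule closure_minimal) (auto simp: closed_Sigma_mu)
  ultimately show ?thesis by metis
qed

lemma Sigma_mu_three_intervals:
  "\<exists>(n::nat) (a::nat \<Rightarrow> real) b. n \<le> 3 \<and> Sigma_mu \<gamma> \<mu> = (\<Union>i<n. {a i .. b i})"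
proof -
  obtain a1 b1 where 1: "closure (Sigma_mu \<gamma> \<mu> \<inter> {..<0}) = {a1..b1}" "{a1..b1} \<subseteq> Sigma_mu \<gamma> \<mu>"
    using Sigma_mu_component_closure[of "{..<0}" \<gamma> \<mu>] by (force simp: is_interval_1)
  obtain a2 b2 where 2: "closure (Sigma_mu \<gamma> \<mu> \<inter> {18<..}) = {a2..b2}" "{a2..b2} \<subseteq> Sigma_mu \<gamma> \<mu>"
    using Sigma_mu_component_closure[of "{18<..}" \<gamma> \<mu>] by (force simp: is_interval_1)
  have "Sigma_mu \<gamma> \<mu> = {a1..b1} \<union> {0..18} \<union> {a2..b2}"
  proof
    show "Sigma_mu \<gamma> \<mu> \<subseteq> {a1..b1} \<union> {0..18} \<union> {a2..b2}"
    proof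
      fix z assume z: "z \<in> Sigma_mu \<gamma> \<mu>"
      consider "z \<in> {0..18}" | "z \<in> {..<0}" | "z \<in> {18<..}"
        by (meson atLeastAtMost_iff greaterThan_iff lessThan_iff not_le)
      then show "z \<in> {a1..b1} \<union> {0..18} \<union> {a2..b2}"
        using z 1(1) 2(1) closure_subset[of "Sigma_mu \<gamma> \<mu> \<inter> {..<0}"]
          closure_subset[of "Sigma_mu \<gamma> \<mu> \<inter> {18<..}"]
        by cases auto
    qed
  qed (use 1 2 interval_subset_Sigma_mu in auto)
  \<comment> \<open>The count is always 3: a half-line without zeros contributes an empty
    interval.\<close>
  also have "\<dots> = (\<Union>i<3. {[a1, 0, a2] ! i .. [b1, 18, b2] ! i})"
    by (simp add: numeral_3_eq_3 lessThan_Suc Un_ac)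
  finally show ?thesis by (intro exI[of _ 3] exI[of _ "nth [a1, 0, a2]"] exI[of _ "nth [b1, 18, b2]"]) simp
qed

section \<open>Points outside the essential spectrum\<close>

lemma tendsto_0_nonneg_le:
  fixes a b :: "nat \<Rightarrow> real"
  assumes "b \<longlonglongrightarrow> 0" "\<And>n. 0 \<le> a n" "\<And>n. a n \<le> b n"
  shows "a \<longlonglongrightarrow> 0"
  by (rule tendsto_sandwich[OF _ _ tendsto_const assms(1)]) (use assms in auto)

abbreviation TT :: "((real^3) \<times> (real^3)) measure" where
  "TT \<equiv> T3 \<Otimes>\<^sub>M T3"

lemma space_TT: "space TT = UNIV" by (simp add: space_pair_measure)

lemma Hspace_iff:
  "f \<in> Hspace \<longleftrightarrow> sq_int T3 (fst f) \<and> sq_int TT (snd f) \<and> (\<forall>k p. snd f (k, p) = snd f (p, k))"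
  by (auto simp: Hspace_def sq_int_def)

lemma Hnorm_eq: "Hnorm f = sqrt (nsq T3 (fst f) + nsq TT (snd f))"
  by (simp add: Hnorm_def nsq_def)

lemma Hnorm_1_iff: "Hnorm f = 1 \<longleftrightarrow> nsq T3 (fst f) + nsq TT (snd f) = 1"
  unfolding Hnorm_eq by simp

lemma Hnorm_tendsto_0_iff:
  "((\<lambda>n. Hnorm (f n)) \<longlonglongrightarrow> 0) \<longleftrightarrow> (\<lambda>n. nsq T3 (fst (f n))) \<longlonglongrightarrow> 0 \<and> (\<lambda>n. nsq TT (snd (f n))) \<longlonglongrightarrow> 0"
proof
  assume "(\<lambda>n. Hnorm (f n)) \<longlonglongrightarrow> 0"
  then have "(\<lambda>n. (Hnorm (f n))\<^sup>2) \<longlonglongrightarrow> 0\<^sup>2" by (rule tendsto_power)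
  then have l: "(\<lambda>n. nsq T3 (fst (f n)) + nsq TT (snd (f n))) \<longlonglongrightarrow> 0"
    by (simp add: Hnorm_eq nsq_nonneg)
  show "(\<lambda>n. nsq T3 (fst (f n))) \<longlonglongrightarrow> 0 \<and> (\<lambda>n. nsq TT (snd (f n))) \<longlonglongrightarrow> 0"
    using tendsto_sandwich[OF _ _ tendsto_const l] by (auto simp: nsq_nonneg)
next
  assume "(\<lambda>n. nsq T3 (fst (f n))) \<longlonglongrightarrow> 0 \<and> (\<lambda>n. nsq TT (snd (f n))) \<longlonglongrightarrow> 0"
  then have "(\<lambda>n. sqrt (nsq T3 (fst (f n)) + nsq TT (snd (f n)))) \<longlonglongrightarrow> sqrt (0 + 0)"
    by (intro tendsto_real_sqrt tendsto_add) auto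
  then show "(\<lambda>n. Hnorm (f n)) \<longlonglongrightarrow> 0" by (simp add: Hnorm_eq)
qed

lemma nsq_bounded_mult:
  assumes "sq_int M f" "h \<in> borel_measurable M" "\<And>x. cmod (h x) \<le> C"
  shows sq_int_bounded_mult: "sq_int M (\<lambda>x. h x * f x)"
    and "nsq M (\<lambda>x. h x * f x) \<le> C\<^sup>2 * nsq M f"
proof -
  have "(\<lambda>x. h x * f x) \<in> borel_measurable M"
    using assms(2) sq_int_measurable[OF assms(1)] by measurable
  moreover have "AE x in M. cmod (h x * f x) \<le> C * cmod (f x)"
    using assms(3) by (intro AE_I2) (simp add: norm_mult mult_right_mono)
  ultimately show "sq_int M (\<lambda>x. h x * f x)" "nsq M (\<lambda>x. h x * f x) \<le> C\<^sup>2 * nsq M f"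
    using nsq_dominated[OF assms(1)] by blast+
qed

text \<open>Complex spectral parameters are admitted so that non-real points can be excluded from the
  essential spectrum by the same estimate as real ones.\<close>

definition cDelta :: "real \<Rightarrow> real \<Rightarrow> real^3 \<Rightarrow> complex \<Rightarrow> complex" where
  "cDelta \<gamma> \<mu> k z = of_real (w1 \<gamma> k) - z - of_real (\<mu>\<^sup>2 / 2) * (\<integral>t. 1 / (of_real (w2 k t) - z) \<partial>T3)"

lemma cDelta_of_real: "cDelta \<gamma> \<mu> k (of_real z) = of_real (Delta \<gamma> \<mu> k z)"
proof -
  have "1 / (of_real (w2 k t) - of_real z) = (of_real (1 / (w2 k t - z)) :: complex)" for t
    by simp
  then show ?thesis
    unfolding cDelta_def Delta_def Ik_def by (simp only: integral_complex_of_real) simp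
qed

lemma gap_obtain:
  assumes "z \<notin> complex_of_real ` {0..18}"
  obtains d where "d > 0" "\<And>k p. d \<le> cmod (of_real (w2 k p) - z)"
proof -
  have "compact (complex_of_real ` {0..18})"
    by (intro compact_continuous_image continuous_intros) auto
  then have "\<exists>d>0. \<forall>x\<in>complex_of_real ` {0..18}. d \<le> dist z x"
    by (intro separate_point_closed compact_imp_closed assms)
  then show ?thesis using that w2_bounds by (force simp: dist_norm norm_minus_commute)
qed

lemma norm_inverse_gap:
  assumes "d > 0" "\<And>k p. d \<le> cmod (of_real (w2 k p) - z)"
  shows "cmod (1 / (of_real (w2 k p) - z)) \<le> 1 / d"
  using assms(2)[of k p] assms(1) by (auto simp: norm_divide intro!: divide_left_mono mult_pos_pos)

text \<open>For real z a continuous function without zeros on the compact cube is bounded away from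
  zero. For nonreal z the imaginary part is \<open>- Im z\<close> times a factor at least 1, which
  replaces an appeal to the spectrum of a self-adjoint operator being real.\<close>

lemma cDelta_bounded_below:
  assumes z: "z \<notin> complex_of_real ` Sigma_mu \<gamma> \<mu>"
  shows "\<exists>c>0. \<forall>k\<in>Tbox. c \<le> cmod (cDelta \<gamma> \<mu> k z)"
proof (cases "Im z = 0")
  case True
  define x where "x = Re z"
  have zx: "z = of_real x" using True by (simp add: x_def complex_eq_iff)
  have xS: "x \<notin> Sigma_mu \<gamma> \<mu>" using z zx by auto
  then have n: "x \<notin> {0..18}" using interval_subset_Sigma_mu by blast
  have "compact ((\<lambda>k. Delta \<gamma> \<mu> k x) ` Tcl)"
    by (rule compact_continuous_image[OF continuous_on_Delta_fst[OF n] Tcl_compact])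
  moreover have "0 \<notin> (\<lambda>k. Delta \<gamma> \<mu> k x) ` Tcl"
    using xS Sigma_mu_iff[OF n, of \<gamma> \<mu>] by auto
  ultimately have "\<exists>c>0. \<forall>y\<in>(\<lambda>k. Delta \<gamma> \<mu> k x) ` Tcl. c \<le> dist 0 y"
    by (intro separate_point_closed compact_imp_closed)
  then show ?thesis
    using Tbox_subset_Tcl by (auto simp: zx cDelta_of_real dist_real_def)
next
  case False
  then have "z \<notin> complex_of_real ` {0..18}" by auto
  then obtain d where d: "d > 0" "\<And>k p. d \<le> cmod (of_real (w2 k p) - z)" using gap_obtain by blast
  have "\<bar>Im z\<bar> \<le> cmod (cDelta \<gamma> \<mu> k z)" for k
  proof -
    let ?r = "\<lambda>t. 1 / (complex_of_real (w2 k t) - z)"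
    have i: "integrable T3 ?r"
      by (rule T3.integrable_const_bound[where B="1/d"]) (use norm_inverse_gap[OF d] in auto)
    have "Im (\<integral>t. ?r t \<partial>T3) = (\<integral>t. Im (?r t) \<partial>T3)"
      using integral_Im[OF i] by simp
    also have "\<dots> = (\<integral>t. Im z * (1 / (cmod (of_real (w2 k t) - z))\<^sup>2) \<partial>T3)"
      by (simp add: Im_divide cmod_power2)
    also have "\<dots> = Im z * (\<integral>t. 1 / (cmod (of_real (w2 k t) - z))\<^sup>2 \<partial>T3)"
      by (rule integral_mult_right_zero)
    finally have "Im (cDelta \<gamma> \<mu> k z) = - Im z * (1 + \<mu>\<^sup>2 / 2 * (\<integral>t. 1 / (cmod (of_real (w2 k t) - z))\<^sup>2 \<partial>T3))"
      by (simp add: cDelta_def algebra_simps)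
    moreover have "0 \<le> \<mu>\<^sup>2 / 2 * (\<integral>t. 1 / (cmod (of_real (w2 k t) - z))\<^sup>2 \<partial>T3)"
      by (intro mult_nonneg_nonneg integral_nonneg_AE) auto
    ultimately have "\<bar>Im z\<bar> \<le> \<bar>Im (cDelta \<gamma> \<mu> k z)\<bar>"
      by (simp add: abs_mult mult_le_cancel_left1)
    then show ?thesis using abs_Im_le_cmod order_trans by blast
  qed
  then show ?thesis using False by (intro exI[of _ "\<bar>Im z\<bar>"]) auto
qed

definition resid1 :: "real \<Rightarrow> real \<Rightarrow> complex \<Rightarrow> hvec \<Rightarrow> real^3 \<Rightarrow> complex" where
  "resid1 \<gamma> \<mu> z \<phi> k = fst (Aop \<gamma> \<mu> \<phi>) k - z * fst \<phi> k"

definition resid2 :: "real \<Rightarrow> real \<Rightarrow> complex \<Rightarrow> hvec \<Rightarrow> (real^3) \<times> (real^3) \<Rightarrow> complex" where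
  "resid2 \<gamma> \<mu> z \<phi> x = snd (Aop \<gamma> \<mu> \<phi>) x - z * snd \<phi> x"

lemma ess_spectrum_iff:
  "z \<in> ess_spectrum (Aop \<gamma> \<mu>) \<longleftrightarrow>
    (\<exists>\<phi> :: nat \<Rightarrow> hvec. (\<forall>n. \<phi> n \<in> Hspace \<and> nsq T3 (fst (\<phi> n)) + nsq TT (snd (\<phi> n)) = 1)
      \<and> (\<forall>\<psi>\<in>Hspace. (\<lambda>n. Hinner (\<phi> n) \<psi>) \<longlonglongrightarrow> 0)
      \<and> (\<lambda>n. nsq T3 (resid1 \<gamma> \<mu> z (\<phi> n))) \<longlonglongrightarrow> 0 \<and> (\<lambda>n. nsq TT (resid2 \<gamma> \<mu> z (\<phi> n))) \<longlonglongrightarrow> 0)"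
  unfolding ess_spectrum_def mem_Collect_eq Hnorm_1_iff Hnorm_tendsto_0_iff fst_conv snd_conv
    resid1_def[abs_def] resid2_def[abs_def] ..

lemma resid1_eq:
  "resid1 \<gamma> \<mu> z \<phi> k = (of_real (w1 \<gamma> k) - z) * fst \<phi> k + of_real \<mu> * (\<integral>s. snd \<phi> (k, s) \<partial>T3)"
  by (simp add: resid1_def Aop_def algebra_simps)

lemma resid2_eq:
  "resid2 \<gamma> \<mu> z \<phi> x = of_real (\<mu> / 2) * (fst \<phi> (fst x) + fst \<phi> (snd x))
    + (of_real (w2 (fst x) (snd x)) - z) * snd \<phi> x"
  by (cases x) (simp add: resid2_def Aop_def algebra_simps add_divide_distrib)

text \<open>Both lifts preserve the norm because the marginals of \<open>TT\<close> are
  \<open>T3\<close>, whence 2 + 2 = 4.\<close>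

lemma sq_int_lift_sum:
  assumes "sq_int T3 f"
  shows "sq_int TT (\<lambda>x. f (fst x) + f (snd x))"
    and "nsq TT (\<lambda>x. f (fst x) + f (snd x)) \<le> 4 * nsq T3 f"
  using nsq_add[of TT "\<lambda>x. f (fst x)" "\<lambda>x. f (snd x)"] nsq_pair_fst_snd[OF prob_space_T3 prob_space_T3] assms
  by auto

lemma sq_int_resid:
  assumes "\<phi> \<in> Hspace"
  shows "sq_int T3 (resid1 \<gamma> \<mu> z \<phi>)" "sq_int TT (resid2 \<gamma> \<mu> z \<phi>)"
proof -
  have f: "sq_int T3 (fst \<phi>)" and g: "sq_int TT (snd \<phi>)" using assms by (auto simp: Hspace_iff)
  have "sq_int T3 (\<lambda>k. (of_real (w1 \<gamma> k) - z) * fst \<phi> k)"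
  proof (rule sq_int_bounded_mult[OF f, where C="6 + \<bar>\<gamma>\<bar> + cmod z"])
    show "cmod (of_real (w1 \<gamma> k) - z) \<le> 6 + \<bar>\<gamma>\<bar> + cmod z" for k
    proof -
      have "cmod (of_real (w1 \<gamma> k) - z) \<le> \<bar>w1 \<gamma> k\<bar> + cmod z"
        using norm_triangle_ineq4[of "of_real (w1 \<gamma> k)" z] by simp
      then show ?thesis using eps_bounds[of k] by (simp add: w1_def)
    qed
  qed measurable
  then show "sq_int T3 (resid1 \<gamma> \<mu> z \<phi>)"
    unfolding resid1_eq[abs_def]
    by (intro sq_int_add sq_int_cmult(1) sq_int_partial_integral[OF prob_space_T3 prob_space_T3 g])
  have "sq_int TT (\<lambda>x. (of_real (w2 (fst x) (snd x)) - z) * snd \<phi> x)"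
  proof (rule sq_int_bounded_mult[OF g, where C="18 + cmod z"])
    show "cmod (of_real (w2 (fst x) (snd x)) - z) \<le> 18 + cmod z" for x
      using norm_triangle_ineq4[of "of_real (w2 (fst x) (snd x))" z] w2_bounds[of "fst x" "snd x"] by simp
  qed measurable
  then show "sq_int TT (resid2 \<gamma> \<mu> z \<phi>)"
    unfolding resid2_eq[abs_def] by (intro sq_int_add sq_int_cmult(1) sq_int_lift_sum(1) f)
qed

text \<open>Up to the factor mu^2 / 2, the compact part of the Schur complement of A - z with
  respect to the first component.\<close>

definition Kint :: "complex \<Rightarrow> (real^3 \<Rightarrow> complex) \<Rightarrow> real^3 \<Rightarrow> complex" where
  "Kint z f k = (\<integral>p. 1 / (of_real (w2 k p) - z) * f p \<partial>T3)"

section \<open>Estimates for the eliminated equation when z has distance at least d from the values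
  of \<open>w2\<close>\<close>

context
  fixes z :: complex and d :: real
  assumes d: "d > 0" "\<And>k p. d \<le> cmod (of_real (w2 k p) - z)"
begin

lemma w2_neq: "of_real (w2 k p) \<noteq> z"
  using d(2)[of k p] d(1) by auto

lemma sq_int_resolvent_section:
  assumes "sq_int T3 f"
  shows "sq_int T3 (\<lambda>p. 1 / (of_real (w2 k p) - z) * f p)"
    and "nsq T3 (\<lambda>p. 1 / (of_real (w2 k p) - z) * f p) \<le> (1 / d)\<^sup>2 * nsq T3 f"
  by (rule nsq_bounded_mult[OF assms], measurable, rule norm_inverse_gap[OF d])+

lemma sq_int_resolvent:
  assumes "sq_int TT g"
  shows "sq_int TT (\<lambda>x. 1 / (of_real (w2 (fst x) (snd x)) - z) * g x)"
    and "nsq TT (\<lambda>x. 1 / (of_real (w2 (fst x) (snd x)) - z) * g x) \<le> (1 / d)\<^sup>2 * nsq TT g"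
  by (rule nsq_bounded_mult[OF assms], measurable, rule norm_inverse_gap[OF d])+

text \<open>A bound at every single k, not merely in norm: it supplies the constant majorant in
  \<open>Kint_weakly_null\<close>.\<close>

lemma norm_Kint_le:
  assumes "sq_int T3 f"
  shows "(cmod (Kint z f k))\<^sup>2 \<le> (1 / d)\<^sup>2 * nsq T3 f"
  unfolding Kint_def
  using T3.nsq_expectation(2)[OF sq_int_resolvent_section(1)[OF assms, of k]] sq_int_resolvent_section(2)[OF assms, of k]
  by linarith

lemma measurable_Kint:
  assumes "sq_int T3 f"
  shows "Kint z f \<in> borel_measurable T3"
proof -
  have [measurable]: "f \<in> borel_measurable T3" using assms by (rule sq_int_measurable)
  show ?thesis unfolding Kint_def[abs_def] by measurable
qed

lemma sq_int_Kint:
  assumes "sq_int T3 f"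
  shows "sq_int T3 (Kint z f)"
proof (rule T3.sq_int_bounded[OF measurable_Kint[OF assms]])
  show "cmod (Kint z f k) \<le> sqrt ((1 / d)\<^sup>2 * nsq T3 f)" for k
    using norm_Kint_le[OF assms, of k] by (rule real_le_rsqrt)
qed

text \<open>The second component is solved for \<open>snd \<phi>\<close> and integrated over s: the
  term with f(k) leaves the integral and completes \<open>cDelta\<close>, the term with f(s) becomes
  \<open>Kint\<close>. The identity holds for almost every k because only almost every section of
  the residual is known to be square integrable.\<close>

lemma cDelta_mult_eq:
  assumes \<phi>: "\<phi> \<in> Hspace"
  shows "AE k in T3. cDelta \<gamma> \<mu> k z * fst \<phi> k =
    resid1 \<gamma> \<mu> z \<phi> k + (of_real (- \<mu>) * (\<integral>s. 1 / (of_real (w2 k s) - z) * resid2 \<gamma> \<mu> z \<phi> (k, s) \<partial>T3)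
      + of_real (\<mu>\<^sup>2 / 2) * Kint z (fst \<phi>) k)"
  using AE_sq_int_section[OF prob_space_T3 prob_space_T3 sq_int_resolvent(1)[OF sq_int_resid(2)[OF \<phi>, of \<gamma> \<mu> z]]]
proof eventually_elim
  case (elim k)
  let ?f = "fst \<phi>" and ?r = "\<lambda>s. 1 / (complex_of_real (w2 k s) - z)"
  let ?R = "\<lambda>s. ?r s * resid2 \<gamma> \<mu> z \<phi> (k, s)"
  have f: "sq_int T3 ?f" using \<phi> by (simp add: Hspace_iff)
  have iR: "integrable T3 ?R" using T3.nsq_expectation(1)[OF elim] by simp
  have iK: "integrable T3 (\<lambda>p. ?r p * ?f p)"
    by (rule T3.nsq_expectation(1)[OF sq_int_resolvent_section(1)[OF f]])
  have ir: "integrable T3 ?r"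
    by (rule T3.integrable_const_bound[where B="1/d"]) (use norm_inverse_gap[OF d] in auto)
  have "snd \<phi> (k, s) = ?R s - of_real (\<mu> / 2) * ?f k * ?r s - of_real (\<mu> / 2) * (?r s * ?f s)" for s
  proof -
    \<comment> \<open>The identity is isolated over plain complex variables; r stands for the
      inverse of \<open>W = w2 - z\<close>.\<close>
    have "r * (m * (a + b) + W * g) - m * a * r - m * (r * b) = g"
      if "r * W = 1" for r W m a b g :: complex
      using that by algebra
    moreover have "?r s * (of_real (w2 k s) - z) = 1" using w2_neq[of k s] by simp
    ultimately show ?thesis unfolding resid2_eq fst_conv snd_conv by metis
  qed
  then have "(\<integral>s. snd \<phi> (k, s) \<partial>T3) = (\<integral>s. ?R s - of_real (\<mu> / 2) * ?f k * ?r s - of_real (\<mu> / 2) * (?r s * ?f s) \<partial>T3)"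
    by (rule Bochner_Integration.integral_cong[OF refl])
  also have "\<dots> = (\<integral>s. ?R s \<partial>T3) - of_real (\<mu> / 2) * ?f k * (\<integral>s. ?r s \<partial>T3) - of_real (\<mu> / 2) * Kint z ?f k"
  proof -
    have "(\<integral>s. F s - a * G s - b * H s \<partial>T3) = (\<integral>s. F s \<partial>T3) - a * (\<integral>s. G s \<partial>T3) - b * (\<integral>s. H s \<partial>T3)"
      if "integrable T3 F" "integrable T3 G" "integrable T3 H" for F G H :: "real^3 \<Rightarrow> complex" and a b
      using that by simp
    from this[OF iR ir iK] show ?thesis unfolding Kint_def .
  qed
  finally have S: "(\<integral>s. snd \<phi> (k, s) \<partial>T3) =
    (\<integral>s. ?R s \<partial>T3) - of_real (\<mu> / 2) * ?f k * (\<integral>s. ?r s \<partial>T3) - of_real (\<mu> / 2) * Kint z ?f k" .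
  show ?case
    unfolding resid1_eq cDelta_def S by (simp add: algebra_simps power2_eq_square)
qed

text \<open>Division of \<open>cDelta_mult_eq\<close> by \<open>cDelta\<close>. Two applications of
  \<open>nsq_add\<close> produce the coefficients 4 mu^2 and mu^4 = 2 * 2 * (mu^2 / 2)^2.\<close>

lemma nsq_fst_le:
  assumes \<phi>: "\<phi> \<in> Hspace" and c: "c > 0" "\<And>k. k \<in> Tbox \<Longrightarrow> c \<le> cmod (cDelta \<gamma> \<mu> k z)"
  shows "nsq T3 (fst \<phi>) \<le> (1 / c)\<^sup>2 * (2 * nsq T3 (resid1 \<gamma> \<mu> z \<phi>)
      + 4 * \<mu>\<^sup>2 * (1 / d)\<^sup>2 * nsq TT (resid2 \<gamma> \<mu> z \<phi>) + \<mu>^4 * nsq T3 (Kint z (fst \<phi>)))"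
proof -
  let ?P = "\<lambda>k. \<integral>s. 1 / (of_real (w2 k s) - z) * resid2 \<gamma> \<mu> z \<phi> (k, s) \<partial>T3"
  let ?R = "\<lambda>k. resid1 \<gamma> \<mu> z \<phi> k + (of_real (- \<mu>) * ?P k + of_real (\<mu>\<^sup>2 / 2) * Kint z (fst \<phi>) k)"
  have f: "sq_int T3 (fst \<phi>)" using \<phi> by (simp add: Hspace_iff)
  note r = sq_int_resid[OF \<phi>, of \<gamma> \<mu> z]
  note P = nsq_partial_integral[OF prob_space_T3 prob_space_T3 sq_int_resolvent(1)[OF r(2)], simplified fst_conv snd_conv]
  have P2: "nsq T3 ?P \<le> (1 / d)\<^sup>2 * nsq TT (resid2 \<gamma> \<mu> z \<phi>)"
    using P(2) sq_int_resolvent(2)[OF r(2)] by linarith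
  note K = sq_int_Kint[OF f]
  note cP = sq_int_cmult[OF P(1), of "of_real (- \<mu>)"] and cK = sq_int_cmult[OF K, of "of_real (\<mu>\<^sup>2 / 2)"]
  note PK = nsq_add[OF cP(1) cK(1)]
  note R = nsq_add[OF r(1) PK(1)]
  have AE: "AE k in T3. cmod (fst \<phi> k) \<le> (1 / c) * cmod (?R k)"
    using cDelta_mult_eq[OF \<phi>, of \<gamma> \<mu>] AE_T3_Tbox
  proof eventually_elim
    case (elim k)
    have "c * cmod (fst \<phi> k) \<le> cmod (cDelta \<gamma> \<mu> k z) * cmod (fst \<phi> k)"
      by (intro mult_right_mono c elim) simp
    also have "\<dots> = cmod (?R k)" using elim(1) by (metis norm_mult)
    finally show ?case using c(1) by (simp add: field_simps)
  qed
  have "nsq T3 (fst \<phi>) \<le> (1 / c)\<^sup>2 * nsq T3 ?R"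
    by (rule nsq_dominated(2)[OF R(1) sq_int_measurable[OF f] AE])
  also have "nsq T3 ?R \<le> 2 * nsq T3 (resid1 \<gamma> \<mu> z \<phi>) + 2 * (2 * (\<mu>\<^sup>2 * nsq T3 ?P) + 2 * ((\<mu>\<^sup>2 / 2)\<^sup>2 * nsq T3 (Kint z (fst \<phi>))))"
    using R(2) PK(2) unfolding cP(2) cK(2) by (simp add: norm_mult norm_divide norm_power)
  also have "\<dots> \<le> 2 * nsq T3 (resid1 \<gamma> \<mu> z \<phi>) + 2 * (2 * (\<mu>\<^sup>2 * ((1 / d)\<^sup>2 * nsq TT (resid2 \<gamma> \<mu> z \<phi>))) + 2 * ((\<mu>\<^sup>2 / 2)\<^sup>2 * nsq T3 (Kint z (fst \<phi>))))"
    using P2 by (intro add_left_mono mult_left_mono add_right_mono) auto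
  also have "\<dots> = 2 * nsq T3 (resid1 \<gamma> \<mu> z \<phi>)
      + 4 * \<mu>\<^sup>2 * (1 / d)\<^sup>2 * nsq TT (resid2 \<gamma> \<mu> z \<phi>) + \<mu>^4 * nsq T3 (Kint z (fst \<phi>))"
    by (simp add: power2_eq_square power4_eq_xxxx)
  finally show ?thesis by (simp add: mult_left_mono)
qed

text \<open>Smallness of the first component and of the residual forces smallness of the second
  component, since the residual equation can be solved for it pointwise.\<close>

lemma nsq_snd_le:
  assumes \<phi>: "\<phi> \<in> Hspace"
  shows "nsq TT (snd \<phi>) \<le> (1 / d)\<^sup>2 * (2 * nsq TT (resid2 \<gamma> \<mu> z \<phi>) + 2 * \<mu>\<^sup>2 * nsq T3 (fst \<phi>))"
proof -
  let ?s = "\<lambda>x. fst \<phi> (fst x) + fst \<phi> (snd x)"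
  have f: "sq_int T3 (fst \<phi>)" using \<phi> by (simp add: Hspace_iff)
  note r = sq_int_resid(2)[OF \<phi>, of \<gamma> \<mu> z]
  note s = sq_int_lift_sum[OF f]
  note cs = sq_int_cmult[OF s(1), of "of_real (- \<mu> / 2)"]
  note R = nsq_add[OF r cs(1)]
  have eq: "snd \<phi> = (\<lambda>x. 1 / (of_real (w2 (fst x) (snd x)) - z) * (resid2 \<gamma> \<mu> z \<phi> x + of_real (- \<mu> / 2) * ?s x))"
  proof
    fix x
    show "snd \<phi> x = 1 / (of_real (w2 (fst x) (snd x)) - z) * (resid2 \<gamma> \<mu> z \<phi> x + of_real (- \<mu> / 2) * ?s x)"
      using w2_neq[of "fst x" "snd x"] by (simp add: resid2_eq field_simps)
  qed
  have "nsq TT (snd \<phi>) \<le> (1 / d)\<^sup>2 * nsq TT (\<lambda>x. resid2 \<gamma> \<mu> z \<phi> x + of_real (- \<mu> / 2) * ?s x)"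
    by (subst (1) eq) (rule sq_int_resolvent(2)[OF R(1)])
  also have "nsq TT (\<lambda>x. resid2 \<gamma> \<mu> z \<phi> x + of_real (- \<mu> / 2) * ?s x)
      \<le> 2 * nsq TT (resid2 \<gamma> \<mu> z \<phi>) + 2 * ((\<mu> / 2)\<^sup>2 * nsq TT ?s)"
    using R(2) unfolding cs(2) by (simp add: norm_mult norm_divide power_divide)
  also have "\<dots> \<le> 2 * nsq TT (resid2 \<gamma> \<mu> z \<phi>) + 2 * ((\<mu> / 2)\<^sup>2 * (4 * nsq T3 (fst \<phi>)))"
    using s(2) by (intro add_left_mono mult_left_mono) auto
  also have "\<dots> = 2 * nsq TT (resid2 \<gamma> \<mu> z \<phi>) + 2 * \<mu>\<^sup>2 * nsq T3 (fst \<phi>)"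
    by (simp add: power2_eq_square)
  finally show ?thesis by (simp add: mult_left_mono)
qed

text \<open>Takes the place of complete continuity of compact operators: each value of
  \<open>Kint\<close> is an inner product with a fixed vector, hence tends to zero, and the values
  are uniformly bounded.\<close>

lemma Kint_weakly_null:
  assumes \<phi>: "\<And>n. \<phi> n \<in> Hspace" and le: "\<And>n. nsq T3 (fst (\<phi> n)) \<le> 1"
    and weak: "\<forall>\<psi>\<in>Hspace. (\<lambda>n. Hinner (\<phi> n) \<psi>) \<longlonglongrightarrow> 0"
  shows "(\<lambda>n. nsq T3 (Kint z (fst (\<phi> n)))) \<longlonglongrightarrow> 0"
proof -
  have f: "sq_int T3 (fst (\<phi> n))" for n using \<phi> by (simp add: Hspace_iff)
  have pt: "(\<lambda>n. Kint z (fst (\<phi> n)) k) \<longlonglongrightarrow> 0" for k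
  proof -
    \<comment> \<open>\<open>Hinner\<close> conjugates its second argument, so the conjugate kernel
      section recovers \<open>Kint\<close> at k.\<close>
    let ?\<psi> = "(\<lambda>p. cnj (1 / (of_real (w2 k p) - z)), \<lambda>_. 0) :: hvec"
    have [measurable]: "cnj \<in> borel_measurable borel"
      by (intro borel_measurable_continuous_onI continuous_intros)
    have "sq_int T3 (\<lambda>p. cnj (1 / (of_real (w2 k p) - z)))"
    proof (rule T3.sq_int_bounded)
      show "cmod (cnj (1 / (of_real (w2 k p) - z))) \<le> 1 / d" for p
        unfolding complex_mod_cnj by (rule norm_inverse_gap[OF d])
    qed measurable
    then have "?\<psi> \<in> Hspace" by (simp add: Hspace_iff sq_int_def)
    then have "(\<lambda>n. Hinner (\<phi> n) ?\<psi>) \<longlonglongrightarrow> 0" using weak by blast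
    then show ?thesis by (simp add: Hinner_def Kint_def)
  qed
  have "(\<lambda>n. \<integral>k. (cmod (Kint z (fst (\<phi> n)) k))\<^sup>2 \<partial>T3) \<longlonglongrightarrow> (\<integral>k. 0 \<partial>T3)"
  proof (rule integral_dominated_convergence[where w="\<lambda>_. (1 / d)\<^sup>2"])
    show "AE k in T3. (\<lambda>n. (cmod (Kint z (fst (\<phi> n)) k))\<^sup>2) \<longlonglongrightarrow> 0"
      using tendsto_power[OF tendsto_norm_zero[OF pt], where n=2] by (intro AE_I2) simp
    show "AE k in T3. norm ((cmod (Kint z (fst (\<phi> n)) k))\<^sup>2) \<le> (1 / d)\<^sup>2" for n
    proof (rule AE_I2)
      fix k
      have "(1 / d)\<^sup>2 * nsq T3 (fst (\<phi> n)) \<le> (1 / d)\<^sup>2 * 1"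
        by (intro mult_left_mono le) auto
      then show "norm ((cmod (Kint z (fst (\<phi> n)) k))\<^sup>2) \<le> (1 / d)\<^sup>2"
        using norm_Kint_le[OF f, of n k] by simp
    qed
    show "(\<lambda>k. (cmod (Kint z (fst (\<phi> n)) k))\<^sup>2) \<in> borel_measurable T3" for n
      using measurable_Kint[OF f] by measurable
  qed auto
  then show ?thesis by (simp add: nsq_def)
qed

end

text \<open>Off \<open>Sigma_mu\<close> both components of a Weyl sequence would tend to zero,
  although their squared norms add up to 1.\<close>

lemma ess_spectrum_subset:
  "ess_spectrum (Aop \<gamma> \<mu>) \<subseteq> complex_of_real ` Sigma_mu \<gamma> \<mu>"
proof (rule subsetI, rule ccontr)
  fix z assume "z \<in> ess_spectrum (Aop \<gamma> \<mu>)" and z: "z \<notin> complex_of_real ` Sigma_mu \<gamma> \<mu>"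
  then obtain \<phi> :: "nat \<Rightarrow> hvec" where \<phi>: "\<And>n. \<phi> n \<in> Hspace"
    and one: "\<And>n. nsq T3 (fst (\<phi> n)) + nsq TT (snd (\<phi> n)) = 1"
    and weak: "\<forall>\<psi>\<in>Hspace. (\<lambda>n. Hinner (\<phi> n) \<psi>) \<longlonglongrightarrow> 0"
    and r: "(\<lambda>n. nsq T3 (resid1 \<gamma> \<mu> z (\<phi> n))) \<longlonglongrightarrow> 0" "(\<lambda>n. nsq TT (resid2 \<gamma> \<mu> z (\<phi> n))) \<longlonglongrightarrow> 0"
    unfolding ess_spectrum_iff by blast
  have "z \<notin> complex_of_real ` {0..18}" using z interval_subset_Sigma_mu by blast
  then obtain d where d: "d > 0" "\<And>k p. d \<le> cmod (of_real (w2 k p) - z)" using gap_obtain by blast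
  obtain c where c: "c > 0" "\<And>k. k \<in> Tbox \<Longrightarrow> c \<le> cmod (cDelta \<gamma> \<mu> k z)"
    using cDelta_bounded_below[OF z] by blast
  have le: "nsq T3 (fst (\<phi> n)) \<le> 1" for n
    using one[of n] nsq_nonneg[of TT "snd (\<phi> n)"] by linarith
  note K = Kint_weakly_null[OF d \<phi> le weak]
  have lim: "(\<lambda>n. C1 * (C2 * u n + C3 * v n + C4 * w n)) \<longlonglongrightarrow> 0"
    if "u \<longlonglongrightarrow> 0" "v \<longlonglongrightarrow> 0" "w \<longlonglongrightarrow> 0" for C1 C2 C3 C4 :: real and u v w :: "nat \<Rightarrow> real"
    using that by (auto intro!: tendsto_eq_intros)
  have F: "(\<lambda>n. nsq T3 (fst (\<phi> n))) \<longlonglongrightarrow> 0"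
    by (rule tendsto_0_nonneg_le[OF lim[OF r K] nsq_nonneg nsq_fst_le[OF d \<phi> c]])
  have "(\<lambda>n. nsq TT (snd (\<phi> n))) \<longlonglongrightarrow> 0"
    \<comment> \<open>The three-term limit serves for two terms, with the zero sequence in the third
      place.\<close>
    using lim[OF r(2) F tendsto_const, of "(1 / d)\<^sup>2" 2 "2 * \<mu>\<^sup>2" 0] nsq_snd_le[OF d \<phi>]
    by (intro tendsto_0_nonneg_le[OF _ nsq_nonneg]) auto
  from tendsto_add[OF F this] have "(\<lambda>n. 1::real) \<longlonglongrightarrow> 0" by (simp add: one)
  then show False by (simp add: LIMSEQ_const_iff)
qed

section \<open>Weyl sequences\<close>

lemma LIMSEQ_one_over_Suc: "(\<lambda>n. 1 / real (Suc n)) \<longlonglongrightarrow> 0"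
  by (rule LIMSEQ_Suc[OF lim_1_over_n])

text \<open>If k lies on a face with coordinate pi, a cube centred at k leaves the torus box. A cube
  with k as its upper corner stays inside, because the lower bound -pi is strict.\<close>

lemma Tbox_neighbourhood:
  assumes k: "k \<in> Tbox" and e: "e > 0"
  shows "\<exists>B\<in>sets borel. 0 < measure T3 B \<and> B \<subseteq> ball k e"
proof -
  \<comment> \<open>The first entry keeps the l1-diameter 3 \<delta> below e; the others keep the
    lower corner above -pi.\<close>
  define \<delta> where "\<delta> = Min (insert (e / 4) (range (\<lambda>i. (k $ i + pi) / 2)))"
  have "0 < (k $ i + pi) / 2" for i
  proof -
    have "- pi < k $ i" using k by (simp add: Tbox_def)
    then show ?thesis by simp
  qed
  then have "\<delta> > 0" using e by (simp add: \<delta>_def)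
  moreover have "\<delta> \<le> e / 4" "\<delta> \<le> (k $ i + pi) / 2" for i
    unfolding \<delta>_def by (rule Min_le; simp)+
  ultimately have \<delta>: "\<delta> > 0" "\<delta> \<le> e / 4" "\<delta> \<le> (k $ i + pi) / 2" for i by auto
  define a :: "real^3" where "a = (\<chi> i. k $ i - \<delta>)"
  have mem: "x \<in> cbox a k \<longleftrightarrow> (\<forall>i. k $ i - \<delta> \<le> x $ i \<and> x $ i \<le> k $ i)" for x
    by (simp add: mem_box_cart a_def)
  have sub: "cbox a k \<subseteq> Tbox"
  proof
    fix x assume x: "x \<in> cbox a k"
    have "- pi < x $ i \<and> x $ i \<le> pi" for i
    proof -
      have "- pi < k $ i" "k $ i \<le> pi" using k by (auto simp: Tbox_def)
      moreover have "k $ i - \<delta> \<le> x $ i" "x $ i \<le> k $ i" using x mem by auto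
      ultimately show ?thesis using \<delta>(3)[of i] by (simp add: field_simps)
    qed
    then show "x \<in> Tbox" by (simp add: Tbox_def)
  qed
  have "x \<in> ball k e" if "x \<in> cbox a k" for x
  proof -
    have "dist k x \<le> (\<Sum>i\<in>UNIV. \<bar>(k - x) $ i\<bar>)" unfolding dist_norm by (rule norm_le_l1_cart)
    also have "\<dots> \<le> (\<Sum>i\<in>(UNIV::3 set). \<delta>)"
    proof (rule sum_mono)
      fix i
      show "\<bar>(k - x) $ i\<bar> \<le> \<delta>" using that mem by (simp add: abs_le_iff) (smt (verit) \<delta>(1))
    qed
    also have "\<dots> < e" using \<delta>(1,2) by simp
    finally show ?thesis by simp
  qed
  then have ball: "cbox a k \<subseteq> ball k e" by blast
  have "0 < (\<Prod>b\<in>(Basis :: (real^3) set). (k - a) \<bullet> b)"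
    by (rule prod_pos) (use \<delta>(1) in \<open>auto simp: Basis_vec_def inner_axis a_def\<close>)
  then have "0 < measure lborel (cbox a k)"
    using \<delta>(1) by (auto simp: measure_lborel_cbox_eq Basis_vec_def inner_axis a_def)
  moreover have "0 < measure lborel Tbox"
    using emeasure_lborel_Tbox by (simp add: measure_def enn2real_positive_iff zero_less_iff_neq_zero)
  moreover have "measure T3 (cbox a k) = measure lborel (Tbox \<inter> cbox a k) / measure lborel Tbox"
    unfolding T3_def by (rule measure_uniform_measure) (use emeasure_lborel_Tbox in auto)
  ultimately have "0 < measure T3 (cbox a k)" using sub by (simp add: Int_absorb1)
  then show ?thesis using ball by (intro bexI[of _ "cbox a k"]) auto
qed

section \<open>Vectors whose support shrinks to a null set\<close>

lemma eventually_notin_shrinking: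
  fixes B :: "nat \<Rightarrow> (real^3) set"
  assumes B: "\<And>n. B n \<subseteq> ball k (1 / Suc n)"
  shows "AE x in T3. eventually (\<lambda>n. x \<notin> B n) sequentially"
  using AE_T3_neq[of k]
proof eventually_elim
  case (elim x)
  have "eventually (\<lambda>n. 1 / real (Suc n) < dist k x) sequentially"
    by (rule order_tendstoD(2)[OF LIMSEQ_one_over_Suc]) (use elim in auto)
  then show ?case by eventually_elim (use B in force)
qed

lemma measure_shrinking_tendsto_0:
  fixes B :: "nat \<Rightarrow> (real^3) set"
  assumes B: "\<And>n. B n \<in> sets borel" "\<And>n. B n \<subseteq> ball k (1 / Suc n)"
  shows "(\<lambda>n. measure T3 (B n)) \<longlonglongrightarrow> 0"
proof -
  have "nsq T3 (\<lambda>x. indicator (B n) x * 1) = measure T3 (B n)" for n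
  proof -
    have "(cmod (indicator (B n) x * 1))\<^sup>2 = indicator (B n) x" for x by (simp add: indicator_def)
    then show ?thesis using B(1) by (simp add: nsq_def)
  qed
  moreover have "(\<lambda>n. nsq T3 (\<lambda>x. indicator (B n) x * 1)) \<longlonglongrightarrow> 0"
    by (rule nsq_shrinking_tendsto_0) (use B eventually_notin_shrinking[OF B(2)] in \<open>auto simp: sq_int_def\<close>)
  ultimately show ?thesis by simp
qed

text \<open>The second component may live on the cross of pairs with at least one coordinate in
  \<open>B n\<close>, as it does for the vectors built at zeros of \<Delta>. The cross also shrinks
  to a null set, which suffices.\<close>

lemma Hinner_shrinking_tendsto_0:
  fixes B :: "nat \<Rightarrow> (real^3) set"
  assumes B: "\<And>n. B n \<in> sets borel" "\<And>n. B n \<subseteq> ball k (1 / Suc n)"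
    and \<phi>: "\<And>n. \<phi> n \<in> Hspace" and one: "\<And>n. nsq T3 (fst (\<phi> n)) + nsq TT (snd (\<phi> n)) = 1"
    and 0: "\<And>n x. x \<notin> B n \<Longrightarrow> fst (\<phi> n) x = 0" "\<And>n x. fst x \<notin> B n \<Longrightarrow> snd x \<notin> B n \<Longrightarrow> snd (\<phi> n) x = 0"
    and \<psi>: "\<psi> \<in> Hspace"
  shows "(\<lambda>n. Hinner (\<phi> n) \<psi>) \<longlonglongrightarrow> 0"
proof -
  note ev = eventually_notin_shrinking[OF B(2)]
  define S where "S n = {x. fst x \<in> B n \<or> snd x \<in> B n}" for n
  have S: "S n \<in> sets TT" for n
  proof -
    have [measurable]: "B n \<in> sets borel" by (rule B)
    have "{x \<in> space TT. fst x \<in> B n \<or> snd x \<in> B n} \<in> sets TT" by measurable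
    then show ?thesis by (simp add: S_def space_TT)
  qed
  have evS: "AE x in TT. eventually (\<lambda>n. x \<notin> S n) sequentially"
    using AE_pair_fst_snd(1)[OF prob_space_T3 prob_space_T3 ev] AE_pair_fst_snd(2)[OF prob_space_T3 prob_space_T3 ev]
  proof eventually_elim
    case (elim x)
    then show ?case by eventually_elim (simp add: S_def)
  qed
  have le: "nsq T3 (fst (\<phi> n)) \<le> 1" "nsq TT (snd (\<phi> n)) \<le> 1" for n
    using one[of n] nsq_nonneg[of T3 "fst (\<phi> n)"] nsq_nonneg[of TT "snd (\<phi> n)"] by linarith+
  have h: "sq_int T3 (fst (\<phi> n))" "sq_int TT (snd (\<phi> n))" for n
    using \<phi>[of n] by (auto simp: Hspace_iff)
  have p: "sq_int T3 (fst \<psi>)" "sq_int TT (snd \<psi>)" using \<psi> by (auto simp: Hspace_iff)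
  have "(\<lambda>n. (\<integral>x. fst (\<phi> n) x * cnj (fst \<psi> x) \<partial>T3) + (\<integral>x. snd (\<phi> n) x * cnj (snd \<psi> x) \<partial>TT)) \<longlonglongrightarrow> 0 + 0"
  proof (intro tendsto_add)
    show "(\<lambda>n. \<integral>x. fst (\<phi> n) x * cnj (fst \<psi> x) \<partial>T3) \<longlonglongrightarrow> 0"
      by (rule inner_shrinking_tendsto_0[where S=B]) (use h le 0 B ev p in auto)
    show "(\<lambda>n. \<integral>x. snd (\<phi> n) x * cnj (snd \<psi> x) \<partial>TT) \<longlonglongrightarrow> 0"
      by (rule inner_shrinking_tendsto_0[where S=S]) (use h le 0 S evS p in \<open>auto simp: S_def\<close>)
  qed
  then show ?thesis by (simp add: Hinner_def)
qed

lemma (in finite_measure) nsq_indicator: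
  assumes "B \<in> sets M"
  shows "sq_int M (\<lambda>x. indicator B x)" "nsq M (\<lambda>x. indicator B x) = measure M B"
proof -
  have "(cmod (indicator B x))\<^sup>2 = indicator B x" for x by (simp add: indicator_def)
  then show "sq_int M (\<lambda>x. indicator B x)" "nsq M (\<lambda>x. indicator B x) = measure M B"
    using assms by (auto simp: sq_int_def nsq_def integrable_indicator_iff less_top[symmetric]
      sets.sets_into_space Int_absorb2)
qed

text \<open>On the diagonal \<open>w2\<close> takes every value in \<open>[0, 18]\<close>, and a neighbourhood \<open>B \<times> B\<close> of a
  diagonal point is symmetric.\<close>

lemma interval_subset_ess_spectrum:
  assumes z: "z \<in> {0..18}"
  shows "complex_of_real z \<in> ess_spectrum (Aop \<gamma> \<mu>)"
proof -
  \<comment> \<open>For q = (t, t, t) the diagonal value is \<open>w2 q q = 9 * (1 - cos t)\<close>,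
    to be solved for the value z.\<close>
  define t where "t = arccos (1 - z / 9)"
  have t: "0 \<le> t" "t \<le> pi" "cos t = 1 - z / 9"
    unfolding t_def by (rule arccos_lbound, use z in simp, use z in simp, rule arccos_ubound,
      use z in simp, use z in simp, rule cos_arccos, use z in simp, use z in simp)
  define q :: "real^3" where "q = (\<chi> i. t)"
  have "- pi < t" using t(1) pi_gt_zero by linarith
  then have q: "q \<in> Tbox" using t by (simp add: Tbox_def q_def)
  have "(1/2) *\<^sub>R (q + q) = q" by (simp add: vec_eq_iff)
  then have wq: "w2 q q = z" using t by (simp add: w2_def eps_def q_def)
  have "\<exists>B. B \<in> sets borel \<and> 0 < measure T3 B \<and> B \<subseteq> ball q (1 / Suc n)
      \<and> (\<forall>k\<in>B. \<forall>p\<in>B. \<bar>w2 k p - z\<bar> \<le> 1 / Suc n)" for n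
  proof -
    have "isCont (\<lambda>x. w2 (fst x) (snd x)) (q, q)"
      using continuous_w2 by (simp add: continuous_on_eq_continuous_at)
    then have "\<exists>e>0. \<forall>x. dist x (q, q) < e \<longrightarrow> dist (w2 (fst x) (snd x)) (w2 (fst (q, q)) (snd (q, q))) < 1 / real (Suc n)"
      unfolding continuous_at_eps_delta by (elim allE[of _ "1 / real (Suc n)"]) simp
    then obtain e where e: "e > 0" and w: "\<And>k p. dist (k, p) (q, q) < e \<Longrightarrow> \<bar>w2 k p - z\<bar> < 1 / real (Suc n)"
      using wq by (auto simp: dist_real_def)
    obtain B where B: "B \<in> sets borel" "0 < measure T3 B" "B \<subseteq> ball q (min (1 / Suc n) (e / 2))"
      using Tbox_neighbourhood[OF q, of "min (1 / Suc n) (e / 2)"] e by auto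
    have "\<bar>w2 k p - z\<bar> \<le> 1 / Suc n" if "k \<in> B" "p \<in> B" for k p
    proof -
      have "dist k q < e / 2" "dist p q < e / 2" using B(3) that by (auto simp: dist_commute subset_iff)
      moreover have "dist (k, p) (q, q) \<le> dist k q + dist p q"
        by (simp add: dist_Pair_Pair sqrt_sum_squares_le_sum)
      ultimately have "dist (k, p) (q, q) < e" by linarith
      then show ?thesis using w by (meson less_imp_le)
    qed
    then show ?thesis using B by (intro exI[of _ B]) auto
  qed
  then obtain B where "\<forall>n. B n \<in> sets borel \<and> 0 < measure T3 (B n) \<and> B n \<subseteq> ball q (1 / Suc n)
      \<and> (\<forall>k\<in>B n. \<forall>p\<in>B n. \<bar>w2 k p - z\<bar> \<le> 1 / Suc n)" by metis
  then have B: "\<And>n. B n \<in> sets borel" "\<And>n. B n \<subseteq> ball q (1 / Suc n)"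
    and v: "\<And>n. 0 < measure T3 (B n)"
    and w: "\<And>n k p. k \<in> B n \<Longrightarrow> p \<in> B n \<Longrightarrow> \<bar>w2 k p - z\<bar> \<le> 1 / Suc n" by auto
  \<comment> \<open>The norm of the indicator of \<open>B n \<times> B n\<close> is the measure of
    \<open>B n\<close>, hence the factor.\<close>
  define \<phi> :: "nat \<Rightarrow> hvec" where
    "\<phi> n = (\<lambda>_. 0, \<lambda>x. of_real (1 / measure T3 (B n)) * indicator (B n \<times> B n) x)" for n
  have BB: "B n \<times> B n \<in> sets TT" for n
    using B(1)[of n] by auto
  have "measure TT (B n \<times> B n) = (measure T3 (B n))\<^sup>2" for n
    using B(1)[of n] T3.emeasure_pair_measure_Times[of "B n" T3 "B n"]
    by (simp add: measure_def enn2real_mult power2_eq_square)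
  then have ind: "sq_int TT (\<lambda>x. indicator (B n \<times> B n) x)"
    "nsq TT (\<lambda>x. indicator (B n \<times> B n) x) = (measure T3 (B n))\<^sup>2" for n
    using TT.P.nsq_indicator[OF BB] by simp_all
  have sq2: "sq_int TT (snd (\<phi> n))" "nsq TT (snd (\<phi> n)) = 1" for n
    using sq_int_cmult[OF ind(1), of "of_real (1 / measure T3 (B n))" n] v[of n]
    by (auto simp: \<phi>_def ind(2) norm_divide power_divide)
  have \<phi>: "\<phi> n \<in> Hspace" for n
    using sq2 by (auto simp: Hspace_iff \<phi>_def sq_int_def indicator_def)
  have one: "nsq T3 (fst (\<phi> n)) + nsq TT (snd (\<phi> n)) = 1" for n
    using sq2 by (simp add: \<phi>_def nsq_def)
  have weak: "\<forall>\<psi>\<in>Hspace. (\<lambda>n. Hinner (\<phi> n) \<psi>) \<longlonglongrightarrow> 0"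
    by (intro ballI Hinner_shrinking_tendsto_0[OF B \<phi> one]) (auto simp: \<phi>_def indicator_def)
  \<comment> \<open>The normalising factor cancels the integral over s, so the coupling leaves mu
    times the indicator of \<open>B n\<close>, whose squared norm vanishes with the measure.\<close>
  have r1: "nsq T3 (resid1 \<gamma> \<mu> z (\<phi> n)) = \<mu>\<^sup>2 * measure T3 (B n)" for n
  proof -
    have "resid1 \<gamma> \<mu> z (\<phi> n) k = of_real \<mu> * indicator (B n) k" for k
    proof -
      have "(\<integral>s. snd (\<phi> n) (k, s) \<partial>T3) = (\<integral>s. of_real (1 / measure T3 (B n)) * indicator (B n) k * of_real (indicator (B n) s) \<partial>T3)"
        by (rule Bochner_Integration.integral_cong) (auto simp: \<phi>_def indicator_def)
      also have "\<dots> = indicator (B n) k"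
        using v[of n] B(1)[of n] by simp
      finally show ?thesis by (simp add: resid1_eq) (simp add: \<phi>_def)
    qed
    then have "resid1 \<gamma> \<mu> z (\<phi> n) = (\<lambda>k. of_real \<mu> * indicator (B n) k)" by blast
    then show ?thesis
      using T3.nsq_indicator[of "B n"] B(1)[of n] sq_int_cmult(2)[of T3 "indicator (B n)" "of_real \<mu>"] by simp
  qed
  have r2: "nsq TT (resid2 \<gamma> \<mu> z (\<phi> n)) \<le> (1 / Suc n)\<^sup>2" for n
  proof -
    have "nsq TT (resid2 \<gamma> \<mu> z (\<phi> n)) \<le> (1 / Suc n)\<^sup>2 * nsq TT (snd (\<phi> n))"
    proof (rule nsq_dominated(2)[OF sq2(1) sq_int_measurable[OF sq_int_resid(2)[OF \<phi>]]], rule AE_I2)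
      fix x
      have "resid2 \<gamma> \<mu> z (\<phi> n) x = of_real (w2 (fst x) (snd x) - z) * snd (\<phi> n) x"
        by (simp add: resid2_eq) (simp add: \<phi>_def)
      then have "cmod (resid2 \<gamma> \<mu> z (\<phi> n) x) = \<bar>w2 (fst x) (snd x) - z\<bar> * cmod (snd (\<phi> n) x)"
        by (simp only: norm_mult norm_of_real)
      also have "\<dots> \<le> 1 / Suc n * cmod (snd (\<phi> n) x)"
      proof (cases "x \<in> B n \<times> B n")
        case True
        then show ?thesis by (intro mult_right_mono w) auto
      qed (simp add: \<phi>_def)
      finally show "cmod (resid2 \<gamma> \<mu> z (\<phi> n) x) \<le> 1 / Suc n * cmod (snd (\<phi> n) x)" .
    qed
    then show ?thesis by (simp add: sq2)
  qed
  have "(\<lambda>n. \<mu>\<^sup>2 * measure T3 (B n)) \<longlonglongrightarrow> 0"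
    using tendsto_mult_right_zero[OF measure_shrinking_tendsto_0[OF B]] .
  moreover have "(\<lambda>n. (1 / real (Suc n))\<^sup>2) \<longlonglongrightarrow> 0\<^sup>2"
    by (intro tendsto_power LIMSEQ_one_over_Suc)
  then have "(\<lambda>n. nsq TT (resid2 \<gamma> \<mu> z (\<phi> n))) \<longlonglongrightarrow> 0"
    using r2 by (intro tendsto_0_nonneg_le[OF _ nsq_nonneg r2]) simp
  ultimately show ?thesis
    unfolding ess_spectrum_iff using \<phi> one weak by (intro exI[of _ \<phi>]) (simp add: r1)
qed

text \<open>The trial vector concentrates \<open>f\<close> near \<open>k\<close> and takes
  \<open>g = - \<mu>/2 (f(k) + f(p)) / (w2 - z)\<close>, which makes the second component of the residual vanish.\<close>

lemma zero_Delta_in_ess_spectrum: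
  assumes k0: "k0 \<in> Tbox" "Delta \<gamma> \<mu> k0 z = 0" and z: "z \<notin> {0..18}"
  shows "complex_of_real z \<in> ess_spectrum (Aop \<gamma> \<mu>)"
proof -
  have "complex_of_real z \<notin> complex_of_real ` {0..18}" using z by auto
  then obtain d where d: "d > 0" "\<And>k p. d \<le> cmod (of_real (w2 k p) - complex_of_real z)"
    using gap_obtain by blast
  have "\<exists>B. B \<in> sets borel \<and> 0 < measure T3 B \<and> B \<subseteq> ball k0 (1 / Suc n)
      \<and> (\<forall>k\<in>B. \<bar>Delta \<gamma> \<mu> k z\<bar> \<le> 1 / Suc n)" for n
  proof -
    have "isCont (\<lambda>k. Delta \<gamma> \<mu> k z) k0"
      using continuous_on_Delta_fst[OF z, of UNIV] by (simp add: continuous_on_eq_continuous_at)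
    then have "\<exists>e>0. \<forall>x. dist x k0 < e \<longrightarrow> dist (Delta \<gamma> \<mu> x z) (Delta \<gamma> \<mu> k0 z) < 1 / real (Suc n)"
      unfolding continuous_at_eps_delta by (elim allE[of _ "1 / real (Suc n)"]) simp
    then obtain e where e: "e > 0" and w: "\<And>k. dist k k0 < e \<Longrightarrow> \<bar>Delta \<gamma> \<mu> k z\<bar> < 1 / real (Suc n)"
      using k0 by (auto simp: dist_real_def)
    obtain B where B: "B \<in> sets borel" "0 < measure T3 B" "B \<subseteq> ball k0 (min (1 / Suc n) e)"
      using Tbox_neighbourhood[OF k0(1), of "min (1 / Suc n) e"] e by auto
    have "\<bar>Delta \<gamma> \<mu> k z\<bar> \<le> 1 / Suc n" if "k \<in> B" for k
      using B(3) that w[of k] by (auto simp: dist_commute subset_iff)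
    then show ?thesis using B by (intro exI[of _ B]) auto
  qed
  then obtain B where "\<forall>n. B n \<in> sets borel \<and> 0 < measure T3 (B n) \<and> B n \<subseteq> ball k0 (1 / Suc n)
      \<and> (\<forall>k\<in>B n. \<bar>Delta \<gamma> \<mu> k z\<bar> \<le> 1 / Suc n)" by metis
  then have B: "\<And>n. B n \<in> sets borel" "\<And>n. B n \<subseteq> ball k0 (1 / Suc n)"
    and v: "\<And>n. 0 < measure T3 (B n)"
    and w: "\<And>n k. k \<in> B n \<Longrightarrow> \<bar>Delta \<gamma> \<mu> k z\<bar> \<le> 1 / Suc n" by auto
  define f :: "nat \<Rightarrow> real^3 \<Rightarrow> complex" where "f n = indicator (B n)" for n
  define g :: "nat \<Rightarrow> (real^3) \<times> (real^3) \<Rightarrow> complex" where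
    "g n x = 1 / (of_real (w2 (fst x) (snd x)) - of_real z) * (of_real (- \<mu> / 2) * (f n (fst x) + f n (snd x)))" for n x
  have f: "sq_int T3 (f n)" "nsq T3 (f n) = measure T3 (B n)" for n
    using T3.nsq_indicator[of "B n"] B(1)[of n] by (auto simp: f_def)
  have g: "sq_int TT (g n)" for n
    unfolding g_def[abs_def] by (intro sq_int_resolvent(1)[OF d] sq_int_cmult(1) sq_int_lift_sum(1) f)
  \<comment> \<open>The norm of the trial vector is not computed: positivity and the lower bound by
    the measure of \<open>B n\<close> are enough.\<close>
  define N where "N n = nsq T3 (f n) + nsq TT (g n)" for n
  have N: "measure T3 (B n) \<le> N n" "N n > 0" for n
    using f(2)[of n] v[of n] nsq_nonneg[of TT "g n"] by (auto simp: N_def)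
  define c where "c n = complex_of_real (1 / sqrt (N n))" for n
  have c2: "(cmod (c n))\<^sup>2 = 1 / N n" for n
    using N(2)[of n] unfolding c_def norm_of_real power2_abs by (simp add: power_divide)
  define \<phi> :: "nat \<Rightarrow> hvec" where "\<phi> n = (\<lambda>k. c n * f n k, \<lambda>x. c n * g n x)" for n
  have \<phi>: "\<phi> n \<in> Hspace" for n
    using sq_int_cmult(1)[OF f(1)] sq_int_cmult(1)[OF g]
    by (auto simp: Hspace_iff \<phi>_def g_def w2_commute add.commute)
  have one: "nsq T3 (fst (\<phi> n)) + nsq TT (snd (\<phi> n)) = 1" for n
  proof -
    have "nsq T3 (fst (\<phi> n)) + nsq TT (snd (\<phi> n)) = (cmod (c n))\<^sup>2 * N n"
      by (simp add: \<phi>_def sq_int_cmult(2)[OF f(1)] sq_int_cmult(2)[OF g] N_def distrib_left)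
    then show ?thesis using N(2)[of n] c2 by simp
  qed
  have weak: "\<forall>\<psi>\<in>Hspace. (\<lambda>n. Hinner (\<phi> n) \<psi>) \<longlonglongrightarrow> 0"
    by (intro ballI Hinner_shrinking_tendsto_0[OF B \<phi> one]) (auto simp: \<phi>_def f_def g_def)
  have r2: "resid2 \<gamma> \<mu> z (\<phi> n) = (\<lambda>_. 0)" for n
  proof
    fix x
    have "m * (c * a + c * b) + W * (c * (r * (- m * (a + b)))) = 0" if "r * W = 1" for r W m a b c :: complex
      using that by algebra
    moreover have "1 / (of_real (w2 (fst x) (snd x)) - of_real z) * (of_real (w2 (fst x) (snd x)) - of_real z) = (1::complex)"
      using w2_neq[OF d, of "fst x" "snd x"] by simp
    ultimately show "resid2 \<gamma> \<mu> z (\<phi> n) x = 0"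
      unfolding resid2_eq \<phi>_def g_def fst_conv snd_conv minus_divide_left[symmetric] of_real_minus by blast
  qed
  \<comment> \<open>Of order measure squared, while the squared normalisation \<open>N n\<close> is
    at least the measure; the quotient therefore tends to zero.\<close>
  have K: "(cmod (Kint z (f n) k))\<^sup>2 \<le> (measure T3 (B n) / d)\<^sup>2" for n k
  proof -
    have "cmod (Kint z (f n) k) \<le> (\<integral>p. cmod (1 / (of_real (w2 k p) - of_real z) * f n p) \<partial>T3)"
      unfolding Kint_def by (rule integral_norm_bound)
    also have "\<dots> \<le> (\<integral>p. 1 / d * indicator (B n) p \<partial>T3)"
    proof (rule integral_mono)
      show "integrable T3 (\<lambda>p. cmod (1 / (of_real (w2 k p) - of_real z) * f n p))"
        by (intro integrable_norm T3.nsq_expectation(1) sq_int_resolvent_section(1)[OF d] f)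
      show "integrable T3 (\<lambda>p. 1 / d * indicator (B n) p :: real)"
        using B(1)[of n] by (intro integrable_mult_right) (simp add: integrable_indicator_iff less_top[symmetric])
      show "cmod (1 / (of_real (w2 k p) - of_real z) * f n p) \<le> 1 / d * indicator (B n) p" for p
        using norm_inverse_gap[OF d, of k p] by (auto simp: f_def indicator_def)
    qed
    also have "\<dots> = measure T3 (B n) / d" using B(1)[of n] by simp
    finally show ?thesis by (intro power_mono) auto
  qed
  have r1: "nsq T3 (resid1 \<gamma> \<mu> z (\<phi> n)) \<le> 2 * (1 / Suc n)\<^sup>2 + \<mu>^4 / (2 * d\<^sup>2) * measure T3 (B n)" for n
  proof -
    let ?D = "\<lambda>k. of_real (Delta \<gamma> \<mu> k z) * fst (\<phi> n) k" and ?K = "\<lambda>k. of_real (- \<mu>\<^sup>2 / 2) * Kint z (fst (\<phi> n)) k"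
    have h: "sq_int T3 (fst (\<phi> n))" using \<phi>[of n] by (simp add: Hspace_iff)
    have Kc: "Kint z (fst (\<phi> n)) k = c n * Kint z (f n) k" for k
      by (simp add: Kint_def \<phi>_def mult.left_commute flip: integral_mult_right_zero)
    \<comment> \<open>The elimination identity read backwards: with vanishing second residual, the
      first one is \<Delta> f minus the compact term.\<close>
    have AE: "AE k in T3. resid1 \<gamma> \<mu> z (\<phi> n) k = ?D k + ?K k"
      using cDelta_mult_eq[OF d \<phi>[of n], of \<gamma> \<mu>]
      by eventually_elim (simp add: r2 cDelta_of_real algebra_simps)
    have mD: "?D \<in> borel_measurable T3"
    proof -
      have [measurable]: "(\<lambda>k. Delta \<gamma> \<mu> k z) \<in> borel_measurable borel"
        by (rule borel_measurable_continuous_onI[OF continuous_on_Delta_fst[OF z]])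
      have [measurable]: "fst (\<phi> n) \<in> borel_measurable T3" using h by (rule sq_int_measurable)
      show ?thesis by measurable
    qed
    have D: "sq_int T3 ?D" "nsq T3 ?D \<le> (1 / Suc n)\<^sup>2 * nsq T3 (fst (\<phi> n))"
    proof -
      have "cmod (?D k) \<le> 1 / Suc n * cmod (fst (\<phi> n) k)" for k
      proof (cases "k \<in> B n")
        case True
        then show ?thesis unfolding norm_mult norm_of_real by (intro mult_right_mono w) auto
      qed (simp add: \<phi>_def f_def)
      then show "sq_int T3 ?D" "nsq T3 ?D \<le> (1 / Suc n)\<^sup>2 * nsq T3 (fst (\<phi> n))"
        using nsq_dominated[OF h mD, of "1 / Suc n"] by auto
    qed
    note K' = sq_int_cmult[OF sq_int_Kint[OF d h], of "of_real (- \<mu>\<^sup>2 / 2)"]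
    have nK: "nsq T3 (Kint z (fst (\<phi> n))) \<le> measure T3 (B n) / d\<^sup>2"
    proof -
      have "nsq T3 (Kint z (fst (\<phi> n))) = (1 / N n) * nsq T3 (Kint z (f n))"
        unfolding Kc[abs_def] sq_int_cmult(2)[OF sq_int_Kint[OF d f(1)]] c2 ..
      also have "\<dots> \<le> 1 / N n * (measure T3 (B n) / d)\<^sup>2"
      proof (rule mult_left_mono)
        have "nsq T3 (Kint z (f n)) \<le> (\<integral>k. (measure T3 (B n) / d)\<^sup>2 \<partial>T3)"
          unfolding nsq_def using sq_int_Kint[OF d f(1)] K by (intro integral_mono) (auto simp: sq_int_def)
        then show "nsq T3 (Kint z (f n)) \<le> (measure T3 (B n) / d)\<^sup>2" by simp
      qed (use N(2)[of n] in simp)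
      also have "\<dots> \<le> 1 / measure T3 (B n) * (measure T3 (B n) / d)\<^sup>2"
        using N[of n] v[of n] by (intro mult_right_mono divide_left_mono) auto
      also have "\<dots> = measure T3 (B n) / d\<^sup>2" using v[of n] by (simp add: power2_eq_square)
      finally show ?thesis .
    qed
    have "nsq T3 (resid1 \<gamma> \<mu> z (\<phi> n)) = nsq T3 (\<lambda>k. ?D k + ?K k)"
      unfolding nsq_def
    proof (rule integral_cong_AE)
      show "AE k in T3. (cmod (resid1 \<gamma> \<mu> z (\<phi> n) k))\<^sup>2 = (cmod (?D k + ?K k))\<^sup>2"
        using AE by eventually_elim simp
    qed (use sq_int_measurable[OF sq_int_resid(1)[OF \<phi>]] sq_int_measurable[OF sq_int_add[OF D(1) K'(1)]] in measurable)
    also have "\<dots> \<le> 2 * nsq T3 ?D + 2 * nsq T3 ?K" by (rule nsq_add(2)[OF D(1) K'(1)])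
    also have "nsq T3 ?K = \<mu>^4 / 4 * nsq T3 (Kint z (fst (\<phi> n)))"
      unfolding K'(2) norm_of_real power2_abs by (simp add: power_divide flip: power_mult)
    also have "2 * nsq T3 ?D + 2 * (\<mu>^4 / 4 * nsq T3 (Kint z (fst (\<phi> n))))
        \<le> 2 * ((1 / Suc n)\<^sup>2 * 1) + 2 * (\<mu>^4 / 4 * (measure T3 (B n) / d\<^sup>2))"
    proof (intro add_mono mult_left_mono nK)
      have "nsq T3 (fst (\<phi> n)) \<le> 1" using one[of n] nsq_nonneg[of TT "snd (\<phi> n)"] by linarith
      then have "(1 / Suc n)\<^sup>2 * nsq T3 (fst (\<phi> n)) \<le> (1 / Suc n)\<^sup>2 * 1" by (intro mult_left_mono) auto
      then show "nsq T3 ?D \<le> (1 / Suc n)\<^sup>2 * 1" using D(2) by linarith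
    qed auto
    finally show ?thesis by (simp add: mult.commute)
  qed
  have "(\<lambda>n. (1 / real (Suc n))\<^sup>2) \<longlonglongrightarrow> 0\<^sup>2"
    by (intro tendsto_power LIMSEQ_one_over_Suc)
  then have "(\<lambda>n. 2 * (1 / real (Suc n))\<^sup>2 + \<mu>^4 / (2 * d\<^sup>2) * measure T3 (B n)) \<longlonglongrightarrow> 2 * 0\<^sup>2 + \<mu>^4 / (2 * d\<^sup>2) * 0"
    by (intro tendsto_add tendsto_mult tendsto_const measure_shrinking_tendsto_0[OF B])
  then have "(\<lambda>n. nsq T3 (resid1 \<gamma> \<mu> z (\<phi> n))) \<longlonglongrightarrow> 0"
    by (intro tendsto_0_nonneg_le[OF _ nsq_nonneg r1]) simp
  moreover have "(\<lambda>n. nsq TT (resid2 \<gamma> \<mu> z (\<phi> n))) \<longlonglongrightarrow> 0"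
    unfolding r2 by (simp add: nsq_def)
  ultimately show ?thesis
    unfolding ess_spectrum_iff using \<phi> one weak by blast
qed

lemma Sigma_mu_subset_ess_spectrum:
  assumes "z \<in> Sigma_mu \<gamma> \<mu>"
  shows "complex_of_real z \<in> ess_spectrum (Aop \<gamma> \<mu>)"
proof (cases "z \<in> {0..18}")
  case False
  then obtain k where "k \<in> Tcl" "Delta \<gamma> \<mu> k z = 0" using assms Sigma_mu_iff by blast
  then show ?thesis using Delta_Tcl_Tbox[of k \<gamma> \<mu>] zero_Delta_in_ess_spectrum[OF _ _ False] by metis
qed (rule interval_subset_ess_spectrum)

theorem theorem2:
  fixes \<mu> \<gamma> :: real
  assumes "\<mu> > 0"
  shows "ess_spectrum (Aop \<gamma> \<mu>) = complex_of_real ` Sigma_mu \<gamma> \<mu>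
       \<and> (\<exists>(n::nat) (a::nat \<Rightarrow> real) b. n \<le> 3
            \<and> Sigma_mu \<gamma> \<mu> = (\<Union>i<n. {a i .. b i}))"
proof
  show "ess_spectrum (Aop \<gamma> \<mu>) = complex_of_real ` Sigma_mu \<gamma> \<mu>"
    using ess_spectrum_subset Sigma_mu_subset_ess_spectrum by (intro equalityI image_subsetI)
qed (rule Sigma_mu_three_intervals)

end
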